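(* Let $r$ be a vertex symbol and $\alpha\in\{+,-\}$. Let $\mathcal{N}_\alpha(r)$ be the set of bidirected graphs defined inductively by: (1) if $\beta\in\{+,-\}$, $r'$ is a vertex symbol distinct from $r$, $G\in\mathcal{A}_\beta(r')$ with $r\notin V(G)$, and $rr'$ is a new edge in which the sign of $r$ is $-\alpha$ and the sign of $r'$ is $\beta$, then $G+rr'\in\mathcal{N}_\alpha(r)$; (2) if $G\in\mathcal{N}_\alpha(r)$, $v\in V(G)$, and $rv$ is a new edge in which the sign of $r$ is $\alpha$, then $G+rv\in\mathcal{N}_\alpha(r)$; (3) if $G_1,G_2\in\mathcal{N}_\alpha(r)$ with $V(G_1)\cap V(G_2)=\{r\}$, then $G_1+G_2\in\mathcal{N}_\alpha(r)$. Then $\mathcal{N}_\alpha(r)$ is exactly the set of almost strong $\alpha$-radials with root $r$.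
   Context: A bidirected graph $G$ is a finite graph (loops and parallel edges allowed) with maps $\partial_+,\partial_-:E(G)\to 2^{V(G)}$ such that for each edge $e$ with (possibly identical) ends $u,v$: $\partial_\alpha(e)\subseteq\{u,v\}$, $\partial_+(e)\cup\partial_-(e)=\{u,v\}$, and $\partial_+(e)\cap\partial_-(e)=\emptyset$ if $e$ is not a loop. If $u\in\partial_\alpha(e)$, the sign of $u$ over $e$ is $\alpha$; $-\alpha$ denotes the opposite sign. A walk is a sequence $W=(w_1,\dots,w_k)$, $k$ odd, with $w_i$ a vertex for odd $i$ and $w_i$ an edge joining $w_{i-1},w_{i+1}$ for even $i$; closed over $r$ if $w_1=w_k=r$; a trail has no repeated edge. $W$ is a diwalk if to each traversal of an edge $w_i$ one can assign signs to its end-occurrences equal to the signs of these vertices over $w_i$ (for a loop with one end $+$ and one end $-$, the two assigned signs are distinct), such that at every internal vertex term the signs assigned from the preceding and following edges are distinct. A ditrail is a diwalk that is a trail. For $k\ge3$ the sign of $w_1$ (resp. $w_k$) over $W$ is the sign assigned at $w_2$ (resp. $w_{k-1}$); $W$ is an $(\alpha,\beta)$-ditrail if these are $\alpha,\beta$; the trivial ditrail $(v)$ counts as both a $(+,-)$- and a $(-,+)$-ditrail. $G$ is an $\alpha$-radial with root $r$ if every $v$ has an $(\alpha,-\alpha)$-ditrail from $v$ to $r$. An $\alpha$-radial $G$ with root $r$ is almost strong if every $v\in V(G)\setminus\{r\}$ has a $(-\alpha,-\alpha)$-ditrail from $v$ to $r$, but $G$ has no $(-\alpha,-\alpha)$-ditrail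 closed over $r$. For a subgraph $H$, a diear relative to $H$ is a diwalk $W$ whose ends lie in $V(H)$, whose edges are not edges of $H$, and which either (i) is a ditrail (simple diear), or (ii) has the form $(v,e,w_3,\dots,w_{k-2},e,v)$, $k\ge7$, where $e$ joins a vertex of $V(H)$ to a vertex outside $V(H)$ and $(w_3,\dots,w_{k-2})$ is a closed ditrail not containing $e$. $H+W$ is $H$ with the vertices and edges of $W$ added. For a vertex symbol $s$ and $\beta\in\{+,-\}$, $\mathcal{A}_\beta(s)$ is the set defined inductively by: every $(-\beta,-\beta)$-ditrail closed over $s$ (a simple diear relative to the one-vertex graph $s$), viewed as a bidirected graph, is in $\mathcal{A}_\beta(s)$; and if $G\in\mathcal{A}_\beta(s)$ and $P$ is a diear relative to $G$, then $G+P\in\mathcal{A}_\beta(s)$.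
   Formalization: The equality is stated for almost strong α-radials with a vertex other than r: the one-vertex graph on r is vacuously an almost strong α-radial, but every graph in N_α(r) has a vertex distinct from r. *)

theory Defs
  imports Main
begin

datatype sign = Pos | Neg

instantiation sign :: uminus
begin
primrec uminus_sign :: "sign \<Rightarrow> sign" where
  "- Pos = Neg"
| "- Neg = Pos"
instance ..
end

text \<open>
  \<open>bd G \<alpha> e\<close> is the set of ends of \<open>e\<close> that have sign \<open>\<alpha>\<close> over \<open>e\<close>. The ends of an edge
  are determined by its two signed boundaries.
\<close>

record ('v, 'e) bigraph =
  verts :: "'v set"
  edges :: "'e set"
  bd :: "sign \<Rightarrow> 'e \<Rightarrow> 'v set"

definition ends :: "('v, 'e) bigraph \<Rightarrow> 'e \<Rightarrow> 'v set" where
  "ends G e = bd G Pos e \<union> bd G Neg e"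

text \<open>
  The boundary maps have domain \<open>edges G\<close>; as total functions they are required to be empty
  elsewhere, so that equality of records is equality of bidirected graphs.
\<close>

definition bidirected_graph :: "('v, 'e) bigraph \<Rightarrow> bool" where
  "bidirected_graph G \<longleftrightarrow>
     finite (verts G) \<and> finite (edges G) \<and>
     (\<forall>e\<in>edges G. \<exists>u\<in>verts G. \<exists>v\<in>verts G.
        ends G e = {u, v} \<and> (u \<noteq> v \<longrightarrow> bd G Pos e \<inter> bd G Neg e = {})) \<and>
     (\<forall>\<alpha> e. e \<notin> edges G \<longrightarrow> bd G \<alpha> e = {})"

definition agree :: "('v, 'e) bigraph \<Rightarrow> ('v, 'e) bigraph \<Rightarrow> bool" where
  "agree G H \<longleftrightarrow> (\<forall>e\<in>edges G \<inter> edges H. \<forall>\<alpha>. bd G \<alpha> e = bd H \<alpha> e)"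

definition subgraph :: "('v, 'e) bigraph \<Rightarrow> ('v, 'e) bigraph \<Rightarrow> bool" where
  "subgraph H G \<longleftrightarrow>
     bidirected_graph H \<and> bidirected_graph G \<and>
     verts H \<subseteq> verts G \<and> edges H \<subseteq> edges G \<and> agree H G"

text \<open>Only meaningful for \<open>agree G H\<close>.\<close>

definition gunion :: "('v, 'e) bigraph \<Rightarrow> ('v, 'e) bigraph \<Rightarrow> ('v, 'e) bigraph" where
  "gunion G H =
     \<lparr>verts = verts G \<union> verts H, edges = edges G \<union> edges H, bd = \<lambda>\<alpha> e. bd G \<alpha> e \<union> bd H \<alpha> e\<rparr>"

text \<open>
  Adds an edge \<open>e\<close> with ends \<open>u\<close>, \<open>v\<close> of signs \<open>\<alpha>\<close>, \<open>\<beta>\<close>. For \<open>u = v\<close> this is a loop, with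
  both signs at \<open>u\<close> if \<open>\<alpha> \<noteq> \<beta>\<close>.
\<close>

definition add_edge ::
  "('v, 'e) bigraph \<Rightarrow> 'e \<Rightarrow> 'v \<Rightarrow> sign \<Rightarrow> 'v \<Rightarrow> sign \<Rightarrow> ('v, 'e) bigraph" where
  "add_edge G e u \<alpha> v \<beta> =
     \<lparr>verts = {u, v} \<union> verts G, edges = insert e (edges G),
      bd = \<lambda>\<gamma>. (bd G \<gamma>)(e := {x. x = u \<and> \<gamma> = \<alpha> \<or> x = v \<and> \<gamma> = \<beta>})\<rparr>"

text \<open>
  A walk \<open>(w\<^sub>1, \<dots>, w\<^sub>k)\<close> is given by the list \<open>vs\<close> of its vertex terms and the list \<open>es\<close> of its
  edge terms.
\<close>

definition walk :: "('v, 'e) bigraph \<Rightarrow> 'v list \<Rightarrow> 'e list \<Rightarrow> bool" where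
  "walk G vs es \<longleftrightarrow>
     length vs = Suc (length es) \<and> set vs \<subseteq> verts G \<and> set es \<subseteq> edges G \<and>
     (\<forall>i < length es. ends G (es ! i) = {vs ! i, vs ! Suc i})"

text \<open>
  \<open>\<sigma> i\<close> and \<open>\<tau> i\<close> are the signs assigned to the first and the second end-occurrence in the
  traversal of the \<open>i\<close>-th edge. Only a loop with one end of each sign satisfies
  \<open>bd G Pos e \<inter> bd G Neg e \<noteq> {}\<close>.
\<close>

definition signing ::
  "('v, 'e) bigraph \<Rightarrow> 'v list \<Rightarrow> 'e list \<Rightarrow> (nat \<Rightarrow> sign) \<Rightarrow> (nat \<Rightarrow> sign) \<Rightarrow> bool" where
  "signing G vs es \<sigma> \<tau> \<longleftrightarrow>
     (\<forall>i < length es.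
        vs ! i \<in> bd G (\<sigma> i) (es ! i) \<and> vs ! Suc i \<in> bd G (\<tau> i) (es ! i) \<and>
        (bd G Pos (es ! i) \<inter> bd G Neg (es ! i) \<noteq> {} \<longrightarrow> \<sigma> i \<noteq> \<tau> i)) \<and>
     (\<forall>i. Suc i < length es \<longrightarrow> \<tau> i \<noteq> \<sigma> (Suc i))"

definition diwalk :: "('v, 'e) bigraph \<Rightarrow> 'v list \<Rightarrow> 'e list \<Rightarrow> bool" where
  "diwalk G vs es \<longleftrightarrow> walk G vs es \<and> (\<exists>\<sigma> \<tau>. signing G vs es \<sigma> \<tau>)"

definition ditrail :: "('v, 'e) bigraph \<Rightarrow> 'v list \<Rightarrow> 'e list \<Rightarrow> bool" where
  "ditrail G vs es \<longleftrightarrow> diwalk G vs es \<and> distinct es"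

definition signed_ditrail ::
  "('v, 'e) bigraph \<Rightarrow> sign \<Rightarrow> sign \<Rightarrow> 'v list \<Rightarrow> 'e list \<Rightarrow> bool" where
  "signed_ditrail G \<alpha> \<beta> vs es \<longleftrightarrow>
     ditrail G vs es \<and>
     (if es = [] then \<beta> = - \<alpha>
      else \<exists>\<sigma> \<tau>. signing G vs es \<sigma> \<tau> \<and> \<sigma> 0 = \<alpha> \<and> \<tau> (length es - 1) = \<beta>)"

definition has_ditrail ::
  "('v, 'e) bigraph \<Rightarrow> sign \<Rightarrow> sign \<Rightarrow> 'v \<Rightarrow> 'v \<Rightarrow> bool" where
  "has_ditrail G \<alpha> \<beta> u v \<longleftrightarrow> (\<exists>vs es. signed_ditrail G \<alpha> \<beta> vs es \<and> hd vs = u \<and> last vs = v)"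

definition radial :: "sign \<Rightarrow> 'v \<Rightarrow> ('v, 'e) bigraph \<Rightarrow> bool" where
  "radial \<alpha> r G \<longleftrightarrow>
     bidirected_graph G \<and> r \<in> verts G \<and> (\<forall>v\<in>verts G. has_ditrail G \<alpha> (- \<alpha>) v r)"

definition almost_strong_radial :: "sign \<Rightarrow> 'v \<Rightarrow> ('v, 'e) bigraph \<Rightarrow> bool" where
  "almost_strong_radial \<alpha> r G \<longleftrightarrow>
     radial \<alpha> r G \<and>
     (\<forall>v\<in>verts G - {r}. has_ditrail G (- \<alpha>) (- \<alpha>) v r) \<and>
     \<not> has_ditrail G (- \<alpha>) (- \<alpha>) r r"

definition walk_graph ::
  "('v, 'e) bigraph \<Rightarrow> 'v list \<Rightarrow> 'e list \<Rightarrow> ('v, 'e) bigraph" where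
  "walk_graph G vs es =
     \<lparr>verts = set vs, edges = set es, bd = \<lambda>\<alpha> e. if e \<in> set es then bd G \<alpha> e else {}\<rparr>"

definition simple_diear ::
  "('v, 'e) bigraph \<Rightarrow> ('v, 'e) bigraph \<Rightarrow> 'v list \<Rightarrow> 'e list \<Rightarrow> bool" where
  "simple_diear G H vs es \<longleftrightarrow>
     ditrail G vs es \<and> {hd vs, last vs} \<subseteq> verts H \<and> set es \<inter> edges H = {}"

definition nonsimple_diear ::
  "('v, 'e) bigraph \<Rightarrow> ('v, 'e) bigraph \<Rightarrow> 'v list \<Rightarrow> 'e list \<Rightarrow> bool" where
  "nonsimple_diear G H vs es \<longleftrightarrow>
     diwalk G vs es \<and> {hd vs, last vs} \<subseteq> verts H \<and> set es \<inter> edges H = {} \<and>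
     (\<exists>v e us fs. vs = v # us @ [v] \<and> es = e # fs @ [e] \<and> fs \<noteq> [] \<and>
        hd us \<notin> verts H \<and> ditrail G us fs \<and> hd us = last us \<and> e \<notin> set fs)"

text \<open>\<open>G\<close> is the ambient graph containing both \<open>H\<close> and the diear.\<close>

definition diear ::
  "('v, 'e) bigraph \<Rightarrow> ('v, 'e) bigraph \<Rightarrow> 'v list \<Rightarrow> 'e list \<Rightarrow> bool" where
  "diear G H vs es \<longleftrightarrow>
     subgraph H G \<and> (simple_diear G H vs es \<or> nonsimple_diear G H vs es)"

inductive_set \<A> :: "sign \<Rightarrow> 'v \<Rightarrow> ('v, 'e) bigraph set"
  for \<beta> :: sign and s :: 'v where
  closed_ditrail:
    "walk_graph K vs es \<in> \<A> \<beta> s"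
    if "bidirected_graph K" "signed_ditrail K (- \<beta>) (- \<beta>) vs es" "hd vs = s" "last vs = s"
| add_diear:
    "gunion G (walk_graph K vs es) \<in> \<A> \<beta> s"
    if "G \<in> \<A> \<beta> s" "diear K G vs es"

text \<open>
  In \<open>add_edge_root\<close>, \<open>v = r\<close> is allowed. In \<open>union\<close>, the condition on the vertex sets does not
  exclude a common loop at \<open>r\<close>; \<open>agree\<close> ensures that the union is defined.
\<close>

inductive_set \<N> :: "sign \<Rightarrow> 'v \<Rightarrow> ('v, 'e) bigraph set"
  for \<alpha> :: sign and r :: 'v where
  new_root:
    "add_edge G e r (- \<alpha>) r' \<beta> \<in> \<N> \<alpha> r"
    if "r' \<noteq> r" "G \<in> \<A> \<beta> r'" "r \<notin> verts G" "e \<notin> edges G"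
| add_edge_root:
    "add_edge G e r \<alpha> v \<gamma> \<in> \<N> \<alpha> r"
    if "G \<in> \<N> \<alpha> r" "v \<in> verts G" "e \<notin> edges G"
| union:
    "gunion G\<^sub>1 G\<^sub>2 \<in> \<N> \<alpha> r"
    if "G\<^sub>1 \<in> \<N> \<alpha> r" "G\<^sub>2 \<in> \<N> \<alpha> r" "verts G\<^sub>1 \<inter> verts G\<^sub>2 = {r}" "agree G\<^sub>1 G\<^sub>2"

text \<open>
  The one-vertex graph is vacuously almost strong, but every graph in \<open>\<N> \<alpha> r\<close> has a vertex
  other than \<open>r\<close>.
\<close>

lemma almost_strong_radial_one_vertex:
  "almost_strong_radial \<alpha> r \<lparr>verts = {r}, edges = {}, bd = \<lambda>_ _. {}\<rparr>"
proof -
  let ?G = "\<lparr>verts = {r}, edges = {}, bd = \<lambda>_ _. {}\<rparr>"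
  have "signed_ditrail ?G \<alpha> (- \<alpha>) [r] []"
    by (simp add: signed_ditrail_def ditrail_def diwalk_def walk_def signing_def)
  then have "has_ditrail ?G \<alpha> (- \<alpha>) r r"
    unfolding has_ditrail_def by fastforce
  moreover have "\<not> has_ditrail ?G (- \<alpha>) (- \<alpha>) r r"
    by (cases \<alpha>) (auto simp: has_ditrail_def signed_ditrail_def ditrail_def diwalk_def walk_def)
  ultimately show ?thesis
    by (simp add: almost_strong_radial_def radial_def bidirected_graph_def)
qed

lemma \<N>_verts_neq_root: "G \<in> \<N> \<alpha> r \<Longrightarrow> verts G \<noteq> {r}"
proof (induction rule: \<N>.induct)
  case new_root
  then show ?case by (auto simp: add_edge_def)
next
  case (add_edge_root G v e \<gamma>)
  then show ?case by (auto simp: add_edge_def)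
next
  case (union G\<^sub>1 G\<^sub>2)
  then show ?case by (auto simp: gunion_def)
qed

end

theory Submission
  imports Defs
begin

text \<open>
  Diwalks are paths in a digraph on the pairs \<open>(v, a)\<close>, with the symmetry that reverses paths and
  flips signs. The graphs in \<open>\<A> \<beta> s\<close> are those in which every state has a trail to \<open>(s, \<beta>)\<close>:
  if a subgraph misses a vertex, an edge entering it, followed backwards and then continued along
  a trail to the root until that trail hits the subgraph again, is a diear, nonsimple precisely
  when the trail comes back through the same edge.

  Let \<open>G\<close> be an almost strong \<open>\<alpha>\<close>-radial. A trail to \<open>r\<close> with final sign \<open>- \<alpha>\<close> that passes through
  \<open>r\<close> earlier could be shortened or would contain a forbidden closed ditrail, so edges with sign
  \<open>\<alpha>\<close> at \<open>r\<close> can be deleted. Afterwards, each component of \<open>G - r\<close> is joined to \<open>r\<close> by a single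
  edge, because trails through two different edges would combine to a forbidden closed ditrail;
  hence each component is a strong radial rooted at the other end of its edge.
\<close>

declare split_paired_Ex [simp del] split_paired_All [simp del]

subsection \<open>States and steps\<close>

lemma sign_minus_minus [simp]: "- (- a) = (a :: sign)"
  by (cases a) auto

lemma sign_neq_minus [simp]: "a \<noteq> - a" "- a \<noteq> (a :: sign)"
  by (cases a; simp)+

lemma sign_neq_iff: "a \<noteq> b \<longleftrightarrow> b = - (a :: sign)"
  by (cases a; cases b) auto

lemma sign_minus_eq_iff [simp]: "- a = - b \<longleftrightarrow> a = (b :: sign)"
  by (cases a; cases b) auto

text \<open>
  A state \<open>(v, a)\<close> stands for being at \<open>v\<close> and having to leave it with sign \<open>a\<close>; thus it is
  reached by arriving at \<open>v\<close> with sign \<open>- a\<close>. Reversal of diwalks sends a state to its mate.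
\<close>

definition mate :: "'v \<times> sign \<Rightarrow> 'v \<times> sign" where
  "mate s = (fst s, - snd s)"

lemma mate_mate [simp]: "mate (mate s) = s"
  by (simp add: mate_def)

lemma fst_mate [simp]: "fst (mate s) = fst s"
  by (simp add: mate_def)

lemma mate_Pair [simp]: "mate (v, a) = (v, - a)"
  by (simp add: mate_def)

lemma mate_neq [simp]: "mate s \<noteq> s" "s \<noteq> mate s"
  by (cases s; simp)+

lemma fst_eq_cases: "fst s = fst t \<Longrightarrow> s = t \<or> s = mate t"
  by (cases s; cases t) (auto simp: sign_neq_iff)

text \<open>Since \<open>snd t\<close> is the sign for leaving, arrival at \<open>t\<close> has sign
  \<open>- snd t\<close>. A loop with both signs must be traversed with distinct signs, which for
  states reads \<open>snd s = snd t\<close>.\<close>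

definition step :: "('v, 'e) bigraph \<Rightarrow> 'e \<Rightarrow> 'v \<times> sign \<Rightarrow> 'v \<times> sign \<Rightarrow> bool" where
  "step G e s t \<longleftrightarrow>
     e \<in> edges G \<and> ends G e = {fst s, fst t} \<and>
     fst s \<in> bd G (snd s) e \<and> fst t \<in> bd G (- snd t) e \<and>
     (bd G Pos e \<inter> bd G Neg e \<noteq> {} \<longrightarrow> snd s = snd t)"

lemma step_mate: "step G e s t \<Longrightarrow> step G e (mate t) (mate s)"
  by (auto simp: step_def mate_def)

lemma bidirected_graph_ends:
  assumes "bidirected_graph G" "e \<in> edges G"
  obtains u v where "u \<in> verts G" "v \<in> verts G" "ends G e = {u, v}"
    "u \<noteq> v \<Longrightarrow> bd G Pos e \<inter> bd G Neg e = {}"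
  using assms unfolding bidirected_graph_def by blast

lemma ends_subset_verts:
  "bidirected_graph G \<Longrightarrow> e \<in> edges G \<Longrightarrow> ends G e \<subseteq> verts G"
  by (metis bidirected_graph_ends empty_subsetI insert_subset)

lemma bd_subset_ends: "bd G a e \<subseteq> ends G e"
  by (cases a) (auto simp: ends_def)

lemma step_ends: "step G e s t \<Longrightarrow> ends G e = {fst s, fst t}"
  by (simp add: step_def)

lemma step_edge: "step G e s t \<Longrightarrow> e \<in> edges G"
  by (simp add: step_def)

lemma step_verts:
  assumes "bidirected_graph G" "step G e s t"
  shows "fst s \<in> verts G" "fst t \<in> verts G"
  using ends_subset_verts[OF assms(1), of e] assms(2) by (auto simp: step_def)

text \<open>Up to reversal an edge is a single transition: it fixes the sign at each of its ends,
  and on a loop with both signs the last clause of \<open>step\<close> couples the two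
  choices.\<close>

lemma step_unique:
  assumes "bidirected_graph G" "step G e s t" "step G e s' t'"
  shows "s' = s \<and> t' = t \<or> s' = mate t \<and> t' = mate s"
proof -
  obtain u v where uv: "ends G e = {u, v}" "u \<noteq> v \<Longrightarrow> bd G Pos e \<inter> bd G Neg e = {}"
    using assms step_edge bidirected_graph_ends by metis
  obtain x a y b x' a' y' b' where "s = (x, a)" "t = (y, b)" "s' = (x', a')" "t' = (y', b')"
    by (metis surj_pair)
  then show ?thesis
    using assms(2,3) uv unfolding step_def
    by (cases a; cases b; cases a'; cases b') (auto simp: doubleton_eq_iff)
qed

lemma step_exists:
  assumes "bidirected_graph G" "e \<in> edges G" "u \<in> bd G a e"
  shows "\<exists>t. step G e (u, a) t"
proof -
  obtain x y where xy: "ends G e = {x, y}" "x \<noteq> y \<Longrightarrow> bd G Pos e \<inter> bd G Neg e = {}"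
    using assms bidirected_graph_ends by metis
  have "u \<in> {x, y}"
    using assms(3) bd_subset_ends xy(1) by fastforce
  then obtain v where v: "ends G e = {u, v}"
    using xy by auto
  show ?thesis
  proof (cases "bd G Pos e \<inter> bd G Neg e = {}")
    case True
    have "v \<in> bd G Pos e \<union> bd G Neg e"
      using v by (auto simp: ends_def)
    then obtain b where b: "v \<in> bd G b e"
      by blast
    then have "step G e (u, a) (v, - b)"
      using assms True v by (auto simp: step_def)
    then show ?thesis ..
  next
    \<comment> \<open>Intersecting boundaries mean a loop carrying both signs; passing through it
      preserves the state.\<close>
    case False
    then have "ends G e = {x}"
      using xy by auto
    moreover have "u \<in> ends G e"
      using v by simp
    ultimately have e: "ends G e = {u}"
      by auto
    obtain w where "w \<in> bd G Pos e" "w \<in> bd G Neg e"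
      using False by blast
    then have "w \<in> bd G c e" for c
      by (cases c) auto
    then have "u \<in> bd G c e" for c
      using e bd_subset_ends by (metis singletonD subsetD)
    then have "step G e (u, a) (u, a)"
      using assms(2) e unfolding step_def by simp
    then show ?thesis ..
  qed
qed

lemma step_exists_end:
  assumes "bidirected_graph G" "e \<in> edges G" "u \<in> ends G e"
  shows "\<exists>a t. step G e (u, a) t"
  using assms step_exists unfolding ends_def by fast

text \<open>The right-hand side is the boundary that \<open>add_edge\<close> gives its new edge, so
  a deleted edge can be restored exactly.\<close>

lemma bd_eq_of_step:
  assumes "bidirected_graph G" "step G e (u, a) (v, - b)"
  shows "bd G c e = {x. x = u \<and> c = a \<or> x = v \<and> c = b}"
proof -
  obtain x y where xy: "ends G e = {x, y}" "x \<noteq> y \<Longrightarrow> bd G Pos e \<inter> bd G Neg e = {}"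
    using assms step_edge bidirected_graph_ends by metis
  then have "bd G Pos e \<subseteq> {x, y}" "bd G Neg e \<subseteq> {x, y}"
    by (auto simp: ends_def)
  moreover have "x \<noteq> y \<Longrightarrow> z \<in> bd G Pos e \<Longrightarrow> z \<notin> bd G Neg e" for z
    using xy(2) by blast
  ultimately show ?thesis
    using assms(2) xy(1) unfolding step_def
    by (cases "x = y"; cases a; cases b; cases c) (auto simp: doubleton_eq_iff)
qed

subsection \<open>Diwalks as paths of states\<close>

primrec dipath :: "('v, 'e) bigraph \<Rightarrow> 'v \<times> sign \<Rightarrow> 'e list \<Rightarrow> 'v \<times> sign \<Rightarrow> bool" where
  "dipath G s [] t \<longleftrightarrow> s = t"
| "dipath G s (e # es) t \<longleftrightarrow> (\<exists>u. step G e s u \<and> dipath G u es t)"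

lemma dipath_append:
  "dipath G s (es @ fs) t \<longleftrightarrow> (\<exists>u. dipath G s es u \<and> dipath G u fs t)"
  by (induction es arbitrary: s) auto

lemma dipath_rev: "dipath G s es t \<Longrightarrow> dipath G (mate t) (rev es) (mate s)"
proof (induction es arbitrary: s)
  case (Cons e es)
  then obtain u where "step G e s u" "dipath G (mate t) (rev es) (mate u)"
    by auto
  then show ?case
    using step_mate[of G e s u] unfolding rev.simps dipath_append dipath.simps by blast
qed auto

lemma dipath_edges: "dipath G s es t \<Longrightarrow> set es \<subseteq> edges G"
  by (induction es arbitrary: s) (auto dest: step_edge)

lemma dipath_verts:
  "bidirected_graph G \<Longrightarrow> dipath G s es t \<Longrightarrow> fst s \<in> verts G \<Longrightarrow> fst t \<in> verts G"
  by (induction es arbitrary: s) (auto dest: step_verts(2))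

definition trail :: "('v, 'e) bigraph \<Rightarrow> 'v \<times> sign \<Rightarrow> 'e list \<Rightarrow> 'v \<times> sign \<Rightarrow> bool" where
  "trail G s es t \<longleftrightarrow> dipath G s es t \<and> distinct es"

lemma trail_Nil [simp]: "trail G s [] t \<longleftrightarrow> s = t"
  by (simp add: trail_def)

lemma trail_append:
  "trail G s (es @ fs) t \<longleftrightarrow>
     (\<exists>u. trail G s es u \<and> trail G u fs t) \<and> set es \<inter> set fs = {}"
  by (auto simp: trail_def dipath_append)

lemma trail_Cons:
  "trail G s (e # es) t \<longleftrightarrow> (\<exists>u. step G e s u \<and> trail G u es t) \<and> e \<notin> set es"
  by (auto simp: trail_def)

lemma trail_rev: "trail G s es t \<Longrightarrow> trail G (mate t) (rev es) (mate s)"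
  by (simp add: trail_def dipath_rev)

primrec vpath ::
  "('v, 'e) bigraph \<Rightarrow> 'v \<times> sign \<Rightarrow> 'v list \<Rightarrow> 'e list \<Rightarrow> 'v \<times> sign \<Rightarrow> bool" where
  "vpath G s vs [] t \<longleftrightarrow> s = t \<and> vs = [fst s]"
| "vpath G s vs (e # es) t \<longleftrightarrow> (\<exists>u ws. vs = fst s # ws \<and> step G e s u \<and> vpath G u ws es t)"

lemma dipath_iff_vpath: "dipath G s es t \<longleftrightarrow> (\<exists>vs. vpath G s vs es t)"
  by (induction es arbitrary: s) auto

lemma vpath_hd: "vpath G s vs es t \<Longrightarrow> vs \<noteq> [] \<and> hd vs = fst s"
  by (cases es) auto

lemma vpath_last: "vpath G s vs es t \<Longrightarrow> last vs = fst t"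
proof (induction es arbitrary: s vs)
  case (Cons e es)
  then obtain u ws where "vs = fst s # ws" "vpath G u ws es t"
    by auto
  then show ?case
    using Cons.IH vpath_hd by (metis last_ConsR)
qed auto

lemma vpath_snoc:
  "vpath G s vs es u \<Longrightarrow> step G e u t \<Longrightarrow> vpath G s (vs @ [fst t]) (es @ [e]) t"
proof (induction es arbitrary: s vs)
  case (Cons f es)
  then obtain x ws where vs: "vs = fst s # ws" and x: "step G f s x" "vpath G x ws es u"
    by auto
  show ?case
    using x Cons.IH[of x ws] Cons.prems(2) unfolding vs append_Cons vpath.simps by blast
qed auto

section \<open>Signings of walks and paths of states\<close>

lemma walk_Cons:
  "walk G (v # w # vs) (e # es) \<longleftrightarrow>
     v \<in> verts G \<and> e \<in> edges G \<and> ends G e = {v, w} \<and> walk G (w # vs) es"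
  by (auto simp: walk_def All_less_Suc2)

lemma signing_Cons:
  "signing G (v # w # vs) (e # es) \<sigma> \<tau> \<longleftrightarrow>
     v \<in> bd G (\<sigma> 0) e \<and> w \<in> bd G (\<tau> 0) e \<and>
     (bd G Pos e \<inter> bd G Neg e \<noteq> {} \<longrightarrow> \<sigma> 0 \<noteq> \<tau> 0) \<and>
     (es \<noteq> [] \<longrightarrow> \<sigma> 1 = - \<tau> 0) \<and>
     signing G (w # vs) es (\<lambda>i. \<sigma> (Suc i)) (\<lambda>i. \<tau> (Suc i))"
proof -
  have "(\<forall>i. Suc i < length (e # es) \<longrightarrow> \<tau> i \<noteq> \<sigma> (Suc i)) \<longleftrightarrow>
    (es \<noteq> [] \<longrightarrow> \<tau> 0 \<noteq> \<sigma> 1) \<and> (\<forall>i. Suc i < length es \<longrightarrow> \<tau> (Suc i) \<noteq> \<sigma> (Suc (Suc i)))"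
    using All_less_Suc2[of "length es - 1" "\<lambda>i. \<tau> i \<noteq> \<sigma> (Suc i)"]
    by (cases es) auto
  then show ?thesis
    unfolding signing_def by (auto simp: All_less_Suc2 sign_neq_iff)
qed

text \<open>Signs are read off the states: \<sigma> from the state before an edge, \<tau> negated
  from the state after it. At internal vertices the two signs then differ automatically.\<close>

lemma vpath_signing:
  assumes "bidirected_graph G" "vpath G s vs es t" "fst s \<in> verts G"
  shows "walk G vs es \<and> (\<exists>\<sigma> \<tau>. signing G vs es \<sigma> \<tau> \<and>
    (es \<noteq> [] \<longrightarrow> \<sigma> 0 = snd s \<and> \<tau> (length es - 1) = - snd t))"
  using assms(2,3)
proof (induction es arbitrary: s vs)
  case Nil
  then show ?case by (auto simp: walk_def signing_def)
next
  case (Cons e es)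
  then obtain u ws where ws: "vs = fst s # ws" and st: "step G e s u" and p: "vpath G u ws es t"
    by auto
  obtain ws' where ws': "ws = fst u # ws'"
    using vpath_hd[OF p] by (cases ws) auto
  from Cons.IH[OF p] step_verts[OF assms(1) st] obtain \<sigma> \<tau> where
    w: "walk G ws es" and sg: "signing G ws es \<sigma> \<tau>"
    and last: "es \<noteq> [] \<longrightarrow> \<sigma> 0 = snd u \<and> \<tau> (length es - 1) = - snd t"
    by blast
  \<comment> \<open>\<open>case_nat\<close> puts the signs of the first edge in front of those of
    the remaining path.\<close>
  let ?\<sigma> = "case_nat (snd s) \<sigma>" and ?\<tau> = "case_nat (- snd u) \<tau>"
  have "signing G vs (e # es) ?\<sigma> ?\<tau>"
    using st sg last unfolding ws ws' signing_Cons by (auto simp: step_def sign_neq_iff)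
  moreover have "?\<tau> (length es) = - snd t"
    using last p by (cases es) auto
  moreover have "walk G vs (e # es)"
    using w st Cons.prems(2) unfolding ws ws' walk_Cons by (auto simp: step_def)
  ultimately show ?case
    by (intro conjI exI[of _ ?\<sigma>] exI[of _ ?\<tau>]) auto
qed

lemma signing_vpath:
  assumes "walk G vs es" "signing G vs es \<sigma> \<tau>" "es \<noteq> []"
  shows "vpath G (hd vs, \<sigma> 0) vs es (last vs, - \<tau> (length es - 1))"
  using assms
proof (induction es arbitrary: vs \<sigma> \<tau>)
  case (Cons e es)
  obtain v w ws where vs: "vs = v # w # ws"
    using Cons.prems(1) by (auto simp: walk_def length_Suc_conv)
  have st: "step G e (v, \<sigma> 0) (w, - \<tau> 0)"
    using Cons.prems unfolding vs walk_Cons signing_Cons step_def by (auto simp: sign_neq_iff)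
  show ?case
  proof (cases "es = []")
    case True
    then have "ws = []"
      using Cons.prems(1) vs by (auto simp: walk_def)
    then show ?thesis
      using st True vs by auto
  next
    case False
    have "vpath G (w, \<sigma> 1) (w # ws) es (last (w # ws), - \<tau> (Suc (length es - 1)))"
      using Cons.IH[of "w # ws" "\<lambda>i. \<sigma> (Suc i)" "\<lambda>i. \<tau> (Suc i)"] Cons.prems False
      unfolding vs walk_Cons signing_Cons by simp
    then show ?thesis
      using st False Cons.prems(2) unfolding vs signing_Cons by fastforce
  qed
qed simp

lemma diwalk_vpath:
  assumes "diwalk G vs es"
  shows "\<exists>a b. vpath G (hd vs, a) vs es (last vs, b)"
proof (cases "es = []")
  case True
  then show ?thesis
    using assms by (auto simp: diwalk_def walk_def length_Suc_conv)
next
  case False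
  then show ?thesis
    using assms signing_vpath unfolding diwalk_def by blast
qed

lemma vpath_diwalk:
  "bidirected_graph G \<Longrightarrow> vpath G s vs es t \<Longrightarrow> fst s \<in> verts G \<Longrightarrow> diwalk G vs es"
  using vpath_signing unfolding diwalk_def by blast

lemma signed_ditrail_trail:
  assumes "signed_ditrail G a b vs es"
  shows "trail G (hd vs, a) es (last vs, - b)"
proof (cases "es = []")
  case True
  then show ?thesis
    using assms by (auto simp: signed_ditrail_def ditrail_def diwalk_def walk_def length_Suc_conv)
next
  case False
  then show ?thesis
    using assms signing_vpath[of G vs es] dipath_iff_vpath
    unfolding signed_ditrail_def ditrail_def diwalk_def trail_def by fastforce
qed

lemma trail_signed_ditrail:
  assumes "bidirected_graph G" "vpath G (u, a) vs es (v, - b)" "distinct es" "u \<in> verts G"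
  shows "signed_ditrail G a b vs es"
proof -
  have "diwalk G vs es"
    using vpath_diwalk assms by fastforce
  moreover have "\<exists>\<sigma> \<tau>. signing G vs es \<sigma> \<tau> \<and> \<sigma> 0 = a \<and> \<tau> (length es - 1) = b" if "es \<noteq> []"
    using vpath_signing[OF assms(1,2)] assms(4) that by fastforce
  moreover have "b = - a" if "es = []"
    using assms(2) that by auto
  ultimately show ?thesis
    using assms(3) by (auto simp: signed_ditrail_def ditrail_def)
qed

text \<open>Ending with sign \<open>b\<close> is ending in a state with sign \<open>- b\<close>. The
  empty trail matches the convention for the trivial ditrail, as \<open>(u, a) = (v, - b)\<close>
  forces \<open>b = - a\<close>.\<close>

lemma has_ditrail_iff_trail:
  assumes "bidirected_graph G" "u \<in> verts G"
  shows "has_ditrail G a b u v \<longleftrightarrow> (\<exists>es. trail G (u, a) es (v, - b))"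
proof
  assume "has_ditrail G a b u v"
  then show "\<exists>es. trail G (u, a) es (v, - b)"
    using signed_ditrail_trail unfolding has_ditrail_def by fastforce
next
  assume "\<exists>es. trail G (u, a) es (v, - b)"
  then obtain vs es where p: "vpath G (u, a) vs es (v, - b)" "distinct es"
    by (auto simp: trail_def dipath_iff_vpath)
  then show "has_ditrail G a b u v"
    using trail_signed_ditrail[OF assms(1) p(1,2) assms(2)] vpath_hd[OF p(1)] vpath_last[OF p(1)]
    unfolding has_ditrail_def by auto
qed

lemma all_sign_iff: "(\<forall>a. P a) \<longleftrightarrow> P b \<and> P (- b)" for b :: sign
  by (metis sign_neq_iff)

text \<open>All ditrails in question end at \<open>r\<close> with sign \<open>- \<alpha>\<close>, so
  everything becomes reachability of the one state \<open>(r, \<alpha>)\<close>. The empty trail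
  settles the radial condition at the root.\<close>

lemma almost_strong_radial_iff:
  "almost_strong_radial \<alpha> r G \<longleftrightarrow>
     bidirected_graph G \<and> r \<in> verts G \<and>
     (\<forall>v\<in>verts G - {r}. \<forall>a. \<exists>es. trail G (v, a) es (r, \<alpha>)) \<and>
     \<not> (\<exists>es. trail G (r, - \<alpha>) es (r, \<alpha>))"
proof (cases "bidirected_graph G \<and> r \<in> verts G")
  case True
  then have iff: "has_ditrail G a b v r \<longleftrightarrow> (\<exists>es. trail G (v, a) es (r, - b))"
    if "v \<in> verts G" for a b v
    using True that by (intro has_ditrail_iff_trail) auto
  have "\<exists>es. trail G (r, \<alpha>) es (r, \<alpha>)"
    by (rule exI[of _ "[]"]) simp
  then have "(\<forall>v\<in>verts G. has_ditrail G \<alpha> (- \<alpha>) v r) \<longleftrightarrow>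
      (\<forall>v\<in>verts G - {r}. \<exists>es. trail G (v, \<alpha>) es (r, \<alpha>))"
    using iff[of _ \<alpha> "- \<alpha>"] by auto
  moreover have "(\<forall>v\<in>verts G - {r}. has_ditrail G (- \<alpha>) (- \<alpha>) v r) \<longleftrightarrow>
      (\<forall>v\<in>verts G - {r}. \<exists>es. trail G (v, - \<alpha>) es (r, \<alpha>))"
    using iff[of _ "- \<alpha>" "- \<alpha>"] by simp
  moreover have "has_ditrail G (- \<alpha>) (- \<alpha>) r r \<longleftrightarrow> (\<exists>es. trail G (r, - \<alpha>) es (r, \<alpha>))"
    using iff[of r "- \<alpha>" "- \<alpha>"] True by simp
  ultimately show ?thesis
    using True unfolding almost_strong_radial_def radial_def all_sign_iff[of _ \<alpha>] ball_conj_distrib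
    by argo
qed (auto simp: almost_strong_radial_def radial_def)

subsection \<open>Trails to a state that is not reached from its mate\<close>

text \<open>
  In the induction, the first edge of \<open>R\<close> on \<open>P\<close> or \<open>Q\<close> either yields the closed trail at once or
  is traversed in opposite directions; then the branching state is moved to that edge, which
  shortens the total length.
\<close>

lemma three_trails:
  assumes "bidirected_graph G"
    and "trail G p P t" "trail G p Q t" "set P \<inter> set Q = {}" "trail G (mate p) R t"
  shows "\<exists>es. trail G (mate t) es t"
  using assms(2-)
proof (induction "length P + length Q + length R" arbitrary: p P Q R rule: less_induct)
  case less
  show ?case
  proof (cases "set R \<inter> (set P \<union> set Q) = {}")
    case True
    then have "trail G (mate t) (rev R @ P) t"
      using less.prems trail_rev[OF less.prems(4)] unfolding trail_append by auto
    then show ?thesis ..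
  next
    case False
    then have "\<exists>g\<in>set R. g \<in> set P \<union> set Q"
      by blast
    then obtain R1 g R2 where R: "R = R1 @ g # R2" and g: "g \<in> set P \<union> set Q"
      and R1: "\<forall>f\<in>set R1. f \<notin> set P \<union> set Q"
      using split_list_first_prop[of R "\<lambda>g. g \<in> set P \<union> set Q"] by blast
    obtain x y where x: "trail G (mate p) R1 x" "step G g x y" "trail G y R2 t"
      "g \<notin> set R2" "g \<notin> set R1" "set R1 \<inter> set R2 = {}"
      using less.prems(4) unfolding R trail_append trail_Cons by auto
    \<comment> \<open>Stated for a variable pair so that it serves \<open>P\<close> and
      \<open>Q\<close> in either order.\<close>
    have main: ?thesis
      if P': "trail G p P' t" and Q': "trail G p Q' t" and disj: "set P' \<inter> set Q' = {}"
        and len: "length P' + length Q' = length P + length Q"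
        and un: "set P' \<union> set Q' = set P \<union> set Q" and "g \<in> set P'" for P' Q'
    proof -
      obtain P1 P3 where eq: "P' = P1 @ g # P3"
        using split_list[OF \<open>g \<in> set P'\<close>] by blast
      obtain x' y' where x': "trail G p P1 x'" "step G g x' y'" "trail G y' P3 t" "g \<notin> set P3"
        using P' unfolding eq trail_append trail_Cons by auto
      have R1': "set R1 \<inter> set P' = {}" "set R1 \<inter> set Q' = {}"
        using R1 un by blast+
      consider "x' = x" "y' = y" | "x' = mate y" "y' = mate x"
        using step_unique[OF assms(1) x(2) x'(2)] by blast
      then show ?thesis
      proof cases
        case 1
        \<comment> \<open>Same direction on \<open>g\<close>: after \<open>R1\<close> the rest of
          \<open>P'\<close> leads to \<open>t\<close>; reversing this and appending
          \<open>Q'\<close> closes the trail.\<close>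
        have "trail G (mate p) (R1 @ g # P3) t"
          using x x' 1 R1' eq unfolding trail_append trail_Cons by auto
        from trail_rev[OF this] have "trail G (mate t) (rev (R1 @ g # P3)) p"
          by simp
        then have "trail G (mate t) (rev (R1 @ g # P3) @ Q') t"
          unfolding trail_append[of G "mate t" _ Q'] using Q' R1' disj eq by auto
        then show ?thesis ..
      next
        case 2
        \<comment> \<open>Opposite directions: \<open>mate x\<close> becomes the branching state,
          with the trails \<open>P3\<close>, \<open>rev R1 @ Q'\<close> and \<open>g # R2\<close>;
          \<open>P1\<close> and one copy of \<open>g\<close> drop out of the total length.\<close>
        have "trail G (mate x) (rev R1) p"
          using trail_rev[OF x(1)] by simp
        then have Q2: "trail G (mate x) (rev R1 @ Q') t"
          using Q' R1' unfolding trail_append by auto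
        have R2: "trail G (mate (mate x)) (g # R2) t"
          using x unfolding trail_Cons by auto
        show ?thesis
        proof (rule less.hyps[OF _ _ Q2 _ R2])
          show "trail G (mate x) P3 t"
            using x' 2 by simp
          show "set P3 \<inter> set (rev R1 @ Q') = {}"
            using R1' disj eq by auto
          show "length P3 + length (rev R1 @ Q') + length (g # R2) < length P + length Q + length R"
            using len R eq by simp
        qed
      qed
    qed
    show ?thesis
    proof (cases "g \<in> set P")
      case True
      then show ?thesis
        using main[of P Q] less.prems by blast
    next
      case False
      then show ?thesis
        using main[of Q P] less.prems g by (simp add: Int_commute Un_commute)
    qed
  qed
qed

text \<open>Let \<open>g\<close> be the last edge of \<open>P\<close> on \<open>Q\<close>. Opposite
  directions on \<open>g\<close> give a closed trail. Equal directions give two disjoint tails from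
  \<open>y\<close>, which \<open>three_trails\<close> forbids unless \<open>y = t\<close>, where
  both trails must stop.\<close>

lemma last_edge_eq:
  assumes G: "bidirected_graph G"
    and no_closed: "\<nexists>es. trail G (mate t) es t"
    and no_out: "\<And>e s. \<not> step G e t s"
    and ex: "\<And>s. fst s \<in> verts G \<Longrightarrow> fst s \<noteq> fst t \<Longrightarrow> \<exists>es. trail G s es t"
    and P: "trail G p P t" and Q: "trail G (mate p) Q t" and "P \<noteq> []" "Q \<noteq> []"
  shows "last P = last Q"
proof -
  have stay: "es = []" if "trail G t es t" for es
    using that no_out by (cases es) (auto simp: trail_Cons)
  have "set P \<inter> set Q \<noteq> {}"
  proof
    assume "set P \<inter> set Q = {}"
    then have "trail G (mate t) (rev P @ Q) t"
      using trail_rev[OF P] Q unfolding trail_append by auto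
    with no_closed show False by blast
  qed
  then have "\<exists>g\<in>set P. g \<in> set Q"
    by blast
  then obtain P1 g P2 where eqP: "P = P1 @ g # P2" and "g \<in> set Q"
    and P2: "\<forall>f\<in>set P2. f \<notin> set Q"
    using split_list_last_prop[of P "\<lambda>g. g \<in> set Q"] by blast
  then obtain Q1 Q2 where eqQ: "Q = Q1 @ g # Q2"
    using split_list by metis
  obtain x y where x: "step G g x y" "trail G y P2 t"
    using P unfolding eqP trail_append trail_Cons by auto
  obtain x' y' where x': "step G g x' y'" "trail G y' Q2 t" "g \<notin> set Q2"
    using Q unfolding eqQ trail_append trail_Cons by auto
  consider "x' = x" "y' = y" | "x' = mate y" "y' = mate x"
    using step_unique[OF G x(1) x'(1)] by blast
  then show ?thesis
  proof cases
    case 1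
    show ?thesis
    proof (cases "y = t")
      case True
      then have "P2 = []" "Q2 = []"
        using stay x x' 1 by auto
      then show ?thesis
        using eqP eqQ by simp
    next
      case False
      \<comment> \<open>Otherwise \<open>P2\<close> would be a closed trail. Hence \<open>y\<close>
        lies off the vertex of \<open>t\<close>, and \<open>ex\<close> supplies the third trail,
        starting from \<open>mate y\<close>.\<close>
      moreover have "y \<noteq> mate t"
        using x(2) no_closed by blast
      ultimately have "fst (mate y) \<noteq> fst t"
        using fst_eq_cases[of y t] by auto
      moreover have "fst (mate y) \<in> verts G"
        using step_verts[OF G x(1)] by simp
      ultimately obtain R where "trail G (mate y) R t"
        using ex by blast
      moreover have "set P2 \<inter> set Q2 = {}"
        using P2 eqQ by auto
      ultimately show ?thesis
        using three_trails[OF G x(2)] x'(2) 1 no_closed by blast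
    qed
  next
    case 2
    \<comment> \<open>Follow \<open>P2\<close> backwards from \<open>mate t\<close> up to
      \<open>g\<close>, cross \<open>g\<close> as \<open>Q\<close> does, and finish along
      \<open>Q2\<close>.\<close>
    have "trail G (mate y) (g # Q2) t"
      using x' 2 unfolding trail_Cons by auto
    then have "trail G (mate t) (rev P2 @ (g # Q2)) t"
      using trail_rev[OF x(2)] P2 eqQ unfolding trail_append by fastforce
    with no_closed show ?thesis by blast
  qed
qed

subsection \<open>Subgraphs\<close>

text \<open>A common form for walk graphs, unions and subgraphs within one ambient graph. Boundaries
  are emptied outside \<open>E\<close> so that such graphs are equal as records.\<close>

definition restrict_graph ::
  "('v, 'e) bigraph \<Rightarrow> 'v set \<Rightarrow> 'e set \<Rightarrow> ('v, 'e) bigraph" where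
  "restrict_graph G V E =
     \<lparr>verts = V, edges = E, bd = \<lambda>a e. if e \<in> E then bd G a e else {}\<rparr>"

lemma restrict_graph_simps [simp]:
  "verts (restrict_graph G V E) = V" "edges (restrict_graph G V E) = E"
  "bd (restrict_graph G V E) a e = (if e \<in> E then bd G a e else {})"
  "ends (restrict_graph G V E) e = (if e \<in> E then ends G e else {})"
  by (auto simp: restrict_graph_def ends_def)

lemma walk_graph_eq: "walk_graph G vs es = restrict_graph G (set vs) (set es)"
  by (simp add: walk_graph_def restrict_graph_def)

lemma gunion_restrict_graph:
  "gunion (restrict_graph G V E) (restrict_graph G V' E') = restrict_graph G (V \<union> V') (E \<union> E')"
  by (auto simp: gunion_def restrict_graph_def fun_eq_iff)

lemma agree_restrict_graph: "agree (restrict_graph G V E) (restrict_graph G V' E')"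
  by (simp add: agree_def)

lemma subgraph_eq_restrict_graph:
  assumes "subgraph H G"
  shows "H = restrict_graph G (verts H) (edges H)"
proof -
  have "bd H a e = (if e \<in> edges H then bd G a e else {})" for a e
    using assms unfolding subgraph_def agree_def bidirected_graph_def by auto
  then show ?thesis
    by (intro bigraph.equality) (simp_all add: fun_eq_iff)
qed

lemma restrict_graph_id: "bidirected_graph G \<Longrightarrow> restrict_graph G (verts G) (edges G) = G"
  using subgraph_eq_restrict_graph[of G G] by (simp add: subgraph_def agree_def)

lemma subgraph_restrict_graph:
  assumes "bidirected_graph G" "V \<subseteq> verts G" "E \<subseteq> edges G" "\<And>e. e \<in> E \<Longrightarrow> ends G e \<subseteq> V"
  shows "subgraph (restrict_graph G V E) G"
proof -
  have "\<exists>u\<in>V. \<exists>v\<in>V. ends G e = {u, v} \<and> (u \<noteq> v \<longrightarrow> bd G Pos e \<inter> bd G Neg e = {})"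
    if "e \<in> E" for e
  proof -
    have "e \<in> edges G"
      using that assms(3) by blast
    from bidirected_graph_ends[OF assms(1) this] obtain u v where
      "ends G e = {u, v}" "u \<noteq> v \<Longrightarrow> bd G Pos e \<inter> bd G Neg e = {}"
      by metis
    then show ?thesis
      using assms(4)[OF that] by blast
  qed
  then have "bidirected_graph (restrict_graph G V E)"
    using assms(1-3) finite_subset[of V] finite_subset[of E]
    unfolding bidirected_graph_def by auto
  then show ?thesis
    using assms by (auto simp: subgraph_def agree_def)
qed

lemma subgraph_ends: "subgraph H G \<Longrightarrow> e \<in> edges H \<Longrightarrow> ends H e = ends G e"
  by (auto simp: subgraph_def agree_def ends_def)

lemma subgraph_ends_subset: "subgraph H G \<Longrightarrow> e \<in> edges H \<Longrightarrow> ends G e \<subseteq> verts H"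
  using subgraph_ends[of H G e] ends_subset_verts[of H e] by (simp add: subgraph_def)

lemma step_subgraph_iff:
  assumes "subgraph H G"
  shows "step H e s t \<longleftrightarrow> e \<in> edges H \<and> step G e s t"
proof (cases "e \<in> edges H")
  case True
  then have "e \<in> edges G" "bd H a e = bd G a e" for a
    using assms by (auto simp: subgraph_def agree_def)
  then show ?thesis
    using True subgraph_ends[OF assms True] by (simp add: step_def)
qed (simp add: step_def)

lemma dipath_subgraph_iff:
  "subgraph H G \<Longrightarrow> dipath H s es t \<longleftrightarrow> set es \<subseteq> edges H \<and> dipath G s es t"
  by (induction es arbitrary: s) (auto simp: step_subgraph_iff)

lemma trail_subgraph_iff:
  "subgraph H G \<Longrightarrow> trail H s es t \<longleftrightarrow> set es \<subseteq> edges H \<and> trail G s es t"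
  by (auto simp: trail_def dipath_subgraph_iff)

subsection \<open>Ear decompositions of strong radials\<close>

text \<open>Unlike in the almost strong case, the root is included with both signs, which demands a
  \<open>(- \<beta>, - \<beta>)\<close>-ditrail closed over \<open>s\<close>.\<close>

definition strong_radial :: "sign \<Rightarrow> 'v \<Rightarrow> ('v, 'e) bigraph \<Rightarrow> bool" where
  "strong_radial \<beta> s G \<longleftrightarrow>
     bidirected_graph G \<and> s \<in> verts G \<and>
     (\<forall>v\<in>verts G. \<forall>a. \<exists>es. trail G (v, a) es (s, \<beta>))"

section \<open>Strong radials are preserved by adding ears\<close>

lemma walk_verts:
  assumes "walk G vs es" "es \<noteq> []"
  shows "set vs = (\<Union>e\<in>set es. ends G e)"
proof
  show "set vs \<subseteq> (\<Union>e\<in>set es. ends G e)"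
  proof
    fix w assume "w \<in> set vs"
    then obtain j where j: "j < Suc (length es)" "w = vs ! j"
      using assms(1) by (auto simp: in_set_conv_nth walk_def)
    have "\<exists>i<length es. w \<in> ends G (es ! i)"
    proof (cases "j < length es")
      case True
      then show ?thesis
        using assms(1) j by (auto simp: walk_def)
    next
      case False
      then have "length es - 1 < length es" "j = Suc (length es - 1)"
        using j assms(2) by auto
      then show ?thesis
        using assms(1) j unfolding walk_def by (metis insertI1 insertI2)
    qed
    then show "w \<in> (\<Union>e\<in>set es. ends G e)"
      by auto
  qed
  show "(\<Union>e\<in>set es. ends G e) \<subseteq> set vs"
    using assms(1) by (auto simp: walk_def in_set_conv_nth[of _ es])
qed

lemma trail_split_at_vertex:
  assumes "trail G x es y" "f \<in> set es" "w \<in> ends G f"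
  shows "\<exists>es1 es2 b. es = es1 @ es2 \<and> trail G x es1 (w, b) \<and> trail G (w, b) es2 y"
proof -
  obtain A B where es: "es = A @ f # B"
    using assms(2) split_list by metis
  then obtain p q where p: "trail G x A p" "step G f p q" "trail G q B y" "f \<notin> set A \<union> set B"
    using assms(1) by (auto simp: trail_append trail_Cons)
  then have A: "trail G p (f # B) y" "trail G x (A @ [f]) q"
    by (auto simp: trail_append trail_Cons)
  have "w = fst p \<or> w = fst q"
    using step_ends[OF p(2)] assms(3) by auto
  then show ?thesis
  proof
    assume "w = fst p"
    then have "(w, snd p) = p"
      by simp
    then show ?thesis
      using p A es by metis
  next
    assume "w = fst q"
    then have "(w, snd q) = q"
      by simp
    moreover have "es = (A @ [f]) @ B"
      using es by simp
    ultimately show ?thesis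
      using p A by metis
  qed
qed

text \<open>From a vertex of the ear, one sign leads forwards to \<open>y\<close> and on along
  \<open>P\<close>, the other backwards to \<open>mate x\<close> and on along \<open>Q\<close>.
  \<open>P\<close> and \<open>Q\<close> may overlap, since only one of them is followed.\<close>

lemma ear_trails:
  assumes "trail G x es y" "f \<in> set es" "w \<in> ends G f" "trail G y P t" "trail G (mate x) Q t"
    "set es \<inter> (set P \<union> set Q) = {}"
  shows "\<exists>fs. trail G (w, a) fs t \<and> set fs \<subseteq> set es \<union> set P \<union> set Q"
proof -
  obtain es1 es2 b where es: "es = es1 @ es2" "trail G x es1 (w, b)" "trail G (w, b) es2 y"
    using trail_split_at_vertex[OF assms(1-3)] by blast
  show ?thesis
  proof (cases "a = b")
    case True
    then have "trail G (w, a) (es2 @ P) t"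
      using es assms unfolding trail_append by auto
    then show ?thesis
      using es(1) by (intro exI[of _ "es2 @ P"]) auto
  next
    case False
    then have "trail G (w, a) (rev es1) (mate x)"
      using trail_rev[OF es(2)] by (auto simp: sign_neq_iff)
    then have "trail G (w, a) (rev es1 @ Q) t"
      using es assms unfolding trail_append by auto
    then show ?thesis
      using es(1) by (intro exI[of _ "rev es1 @ Q"]) auto
  qed
qed

lemma strong_radial_restrict_graph:
  assumes "bidirected_graph G" "V \<subseteq> verts G" "E \<subseteq> edges G" "\<And>e. e \<in> E \<Longrightarrow> ends G e \<subseteq> V" "s \<in> V"
    and "\<And>v a. v \<in> V \<Longrightarrow> \<exists>es. trail G (v, a) es (s, \<beta>) \<and> set es \<subseteq> E"
  shows "strong_radial \<beta> s (restrict_graph G V E)"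
proof -
  have sub: "subgraph (restrict_graph G V E) G"
    using assms by (intro subgraph_restrict_graph)
  then show ?thesis
    using assms(5,6) unfolding strong_radial_def trail_subgraph_iff[OF sub] subgraph_def
    by (metis restrict_graph_simps(1,2))
qed

lemma walk_graph_subset:
  assumes "walk G vs es"
  shows "set vs \<subseteq> verts G" "set es \<subseteq> edges G" "e \<in> set es \<Longrightarrow> ends G e \<subseteq> set vs"
  using assms walk_verts[OF assms] by (cases "es = []"; auto simp: walk_def)+

lemma gunion_walk_graph:
  "subgraph H G \<Longrightarrow>
     gunion H (walk_graph G vs es) = restrict_graph G (verts H \<union> set vs) (edges H \<union> set es)"
  by (metis subgraph_eq_restrict_graph gunion_restrict_graph walk_graph_eq)

text \<open>A closed ditrail is an ear with both exits already at the target, because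
  \<open>mate (s, - \<beta>) = (s, \<beta>)\<close>; so \<open>ear_trails\<close> applies with empty
  continuations.\<close>

lemma strong_radial_closed_ditrail:
  assumes "bidirected_graph G" "signed_ditrail G (- \<beta>) (- \<beta>) vs es" "hd vs = s" "last vs = s"
  shows "strong_radial \<beta> s (walk_graph G vs es)"
  unfolding walk_graph_eq
proof (rule strong_radial_restrict_graph)
  \<comment> \<open>A trivial ditrail would have two opposite signs, not twice
    \<open>- \<beta>\<close>.\<close>
  have w: "walk G vs es" and "es \<noteq> []"
    using assms(2) by (auto simp: signed_ditrail_def ditrail_def diwalk_def split: if_splits)
  have tr: "trail G (s, - \<beta>) es (s, \<beta>)"
    using signed_ditrail_trail[OF assms(2)] assms by simp
  show "\<exists>es'. trail G (v, a) es' (s, \<beta>) \<and> set es' \<subseteq> set es" if "v \<in> set vs" for v a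
  proof -
    have "v \<in> (\<Union>e\<in>set es. ends G e)"
      using that walk_verts[OF w \<open>es \<noteq> []\<close>] by (rule back_subst[of "\<lambda>A. v \<in> A"])
    then obtain f where "f \<in> set es" "v \<in> ends G f"
      by (rule UN_E)
    from ear_trails[OF tr this, of "[]" "(s, \<beta>)" "[]" a] show ?thesis
      by simp
  qed
  show "s \<in> set vs"
    using w assms(3) by (cases vs) (auto simp: walk_def)
qed (use assms walk_graph_subset[of G vs es] in \<open>auto simp: signed_ditrail_def ditrail_def diwalk_def\<close>)

text \<open>A new vertex leaves the ear at either end and continues in \<open>H\<close>, whose edges
  the ear avoids. In a nonsimple diear the closed part \<open>fs\<close> takes the role of the ear,
  and both exits continue over \<open>e\<close> into \<open>H\<close>.\<close>

lemma strong_radial_add_diear: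
  assumes H: "strong_radial \<beta> s H" and ear: "diear G H vs es"
  shows "strong_radial \<beta> s (gunion H (walk_graph G vs es))"
proof -
  have sub: "subgraph H G"
    using ear by (simp add: diear_def)
  then have G: "bidirected_graph G" "verts H \<subseteq> verts G" "edges H \<subseteq> edges G"
    by (auto simp: subgraph_def)
  have dw: "diwalk G vs es"
    using ear by (auto simp: diear_def simple_diear_def nonsimple_diear_def ditrail_def)
  then have w: "walk G vs es"
    by (simp add: diwalk_def)
  have disj: "set es \<inter> edges H = {}"
    using ear by (auto simp: diear_def simple_diear_def nonsimple_diear_def)
  have inH: "\<exists>es. trail G (v, a) es (s, \<beta>) \<and> set es \<subseteq> edges H" if "v \<in> verts H" for v a
    using H that trail_subgraph_iff[OF sub] unfolding strong_radial_def by blast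
  have "\<exists>fs. trail G (v, a) fs (s, \<beta>) \<and> set fs \<subseteq> edges H \<union> set es"
    if v: "v \<in> set vs" "v \<notin> verts H" for v a
    using ear unfolding diear_def
  proof (elim conjE disjE)
    assume "simple_diear G H vs es"
    then have ends: "hd vs \<in> verts H" "last vs \<in> verts H" and d: "distinct es"
      by (auto simp: simple_diear_def ditrail_def)
    obtain b c where "trail G (hd vs, b) es (last vs, c)"
      using diwalk_vpath[OF dw] d unfolding trail_def dipath_iff_vpath by blast
    note tr = this
    have "es \<noteq> []"
      using v ends w by (auto simp: walk_def length_Suc_conv)
    then obtain f where f: "f \<in> set es" "v \<in> ends G f"
      using v walk_verts[OF w] by auto
    obtain P where P: "trail G (last vs, c) P (s, \<beta>)" "set P \<subseteq> edges H"
      using inH ends by blast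
    obtain Q where Q: "trail G (mate (hd vs, b)) Q (s, \<beta>)" "set Q \<subseteq> edges H"
      using inH ends by fastforce
    show ?thesis
      using ear_trails[OF tr f P(1) Q(1), of a] P(2) Q(2) disj by blast
  next
    assume "nonsimple_diear G H vs es"
    then obtain u e us fs where *: "vs = u # us @ [u]" "es = e # fs @ [e]" "fs \<noteq> []"
      "hd us \<notin> verts H" "ditrail G us fs" "e \<notin> set fs" "u \<in> verts H"
      by (auto simp: nonsimple_diear_def)
    have wus: "walk G us fs" "distinct fs"
      using * by (auto simp: ditrail_def diwalk_def)
    then have "us \<noteq> []"
      by (auto simp: walk_def)
    then have "ends G e = {u, hd us}"
      using w * by (cases us) (auto simp: walk_Cons)
    moreover obtain b c z z' where z: "step G e (u, b) z" "dipath G z fs z'" "step G e z' (u, c)"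
      using diwalk_vpath[OF dw] * unfolding dipath_iff_vpath[symmetric]
      by (metis (no_types) dipath_append dipath.simps dipath_iff_vpath last_snoc append_Cons list.sel(1))
    \<comment> \<open>As \<open>hd us\<close> lies outside \<open>H\<close>, \<open>e\<close> is not
      a loop, so its second traversal reverses the first and \<open>fs\<close> runs from
      \<open>z\<close> to \<open>mate z\<close>.\<close>
    ultimately have "fst z \<noteq> u"
      using step_ends[OF z(1)] * by (auto simp: doubleton_eq_iff)
    then have z': "z' = mate z" "(u, c) = mate (u, b)"
      using step_unique[OF G(1) z(1) z(3)] by auto
    obtain P where P: "trail G (u, c) P (s, \<beta>)" "set P \<subseteq> edges H"
      using inH \<open>u \<in> verts H\<close> by blast
    have "e \<notin> set P"
      using P disj * by auto
    then have eP: "trail G (mate z) (e # P) (s, \<beta>)"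
      using P z z' by (auto simp: trail_Cons)
    have "v \<in> set us"
      using v * by auto
    then obtain f where f: "f \<in> set fs" "v \<in> ends G f"
      using walk_verts[OF wus(1)] * by auto
    have tr: "trail G z fs (mate z)"
      using z z' wus by (simp add: trail_def)
    have "set fs \<inter> (set (e # P) \<union> set (e # P)) = {}"
      using * P disj by auto
    from ear_trails[OF tr f eP eP this, of a] show ?thesis
      using P * by auto
  qed
  then have *: "\<exists>fs. trail G (v, a) fs (s, \<beta>) \<and> set fs \<subseteq> edges H \<union> set es"
    if "v \<in> verts H \<union> set vs" for v a
    using inH that by (meson UnE le_supI1)
  have "ends G e \<subseteq> verts H \<union> set vs" if "e \<in> edges H \<union> set es" for e
    using that walk_graph_subset(3)[OF w] subgraph_ends_subset[OF sub] by blast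
  then show ?thesis
    unfolding gunion_walk_graph[OF sub]
    by (intro strong_radial_restrict_graph)
      (use G * H walk_graph_subset[OF w] in \<open>auto simp: strong_radial_def\<close>)
qed

lemma \<A>_strong_radial: "G \<in> \<A> \<beta> s \<Longrightarrow> strong_radial \<beta> s G"
  by (induction rule: \<A>.induct) (auto intro: strong_radial_closed_ditrail strong_radial_add_diear)

text \<open>Cutting at the first entry leaves initial edges with no end in \<open>W\<close>; when
  \<open>W\<close> is the vertex set of a subgraph, they lie outside that subgraph.\<close>

lemma dipath_first_entry:
  assumes "dipath G x es y" "fst x \<notin> W" "fst y \<in> W"
  shows "\<exists>es1 e es2 p q. es = es1 @ e # es2 \<and> dipath G x es1 p \<and> step G e p q \<and>
    fst p \<notin> W \<and> fst q \<in> W \<and> (\<forall>f\<in>set es1. ends G f \<inter> W = {})"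
  using assms
proof (induction es arbitrary: x)
  case (Cons e es)
  then obtain u where u: "step G e x u" "dipath G u es y"
    by auto
  show ?case
  proof (cases "fst u \<in> W")
    case True
    then show ?thesis
      using u Cons.prems by (intro exI[of _ "[]"] exI[of _ e] exI[of _ es] exI[of _ x] exI[of _ u]) auto
  next
    case False
    from Cons.IH[OF u(2) False Cons.prems(3)] obtain es1 f es2 p q where
      "es = es1 @ f # es2" "dipath G u es1 p" "step G f p q"
      "fst p \<notin> W" "fst q \<in> W" "\<forall>g\<in>set es1. ends G g \<inter> W = {}"
      by blast
    moreover have "ends G e \<inter> W = {}"
      using step_ends[OF u(1)] False Cons.prems by auto
    ultimately show ?thesis
      using u(1)
      by (intro exI[of _ "e # es1"] exI[of _ f] exI[of _ es2] exI[of _ p] exI[of _ q]) auto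
  qed
qed simp

text \<open>A trivial walk in \<open>H\<close> is a diear as well; \<open>es \<noteq> []\<close>
  excludes it, so that adding the diear is progress.\<close>

lemma exists_diear:
  assumes G: "strong_radial \<beta> s G" and sub: "subgraph H G" and "s \<in> verts H" "H \<noteq> G"
  shows "\<exists>vs es. diear G H vs es \<and> es \<noteq> []"
proof -
  have bG: "bidirected_graph G"
    using G by (simp add: strong_radial_def)
  show ?thesis
  proof (cases "verts H = verts G")
    \<comment> \<open>With all vertices present, any missing edge alone is a simple diear.\<close>
    case True
    then have "edges H \<noteq> edges G"
      using assms restrict_graph_id[OF bG] subgraph_eq_restrict_graph[OF sub] by metis
    then obtain e where e: "e \<in> edges G" "e \<notin> edges H"
      using sub by (auto simp: subgraph_def)
    then obtain u where "u \<in> ends G e"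
      using bidirected_graph_ends[OF bG] by (metis insertI1)
    then obtain a t where st: "step G e (u, a) t"
      using step_exists_end[OF bG e(1)] by blast
    have v: "u \<in> verts H" "fst t \<in> verts H"
      using True step_verts[OF bG st] by auto
    have "vpath G (u, a) [u, fst t] [e] t"
      using st by auto
    from vpath_diwalk[OF bG this] have "diwalk G [u, fst t] [e]"
      using v True by simp
    then have "diear G H [u, fst t] [e]"
      using sub e v by (auto simp: diear_def simple_diear_def ditrail_def)
    then show ?thesis by blast
  next
    case False
    then obtain v where v: "v \<in> verts G" "v \<notin> verts H"
      using sub by (auto simp: subgraph_def)
    have tr: "\<exists>es. dipath G x es (s, \<beta>) \<and> distinct es" if "fst x \<in> verts G" for x
      using G that unfolding strong_radial_def trail_def by (metis prod.collapse)
    obtain es where "dipath G (v, Pos) es (s, \<beta>)"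
      using tr[of "(v, Pos)"] v by auto
    from dipath_first_entry[OF this, of "verts H"] obtain e x y where
      e: "step G e x y" "fst x \<notin> verts H" "fst y \<in> verts H"
      using v assms(3) by auto
    have xy: "fst x \<in> verts G" "fst y \<in> verts G"
      using step_verts[OF bG e(1)] by auto
    \<comment> \<open>\<open>mate x\<close> is the state in which the reverse traversal of the
      entering edge \<open>e\<close> arrives.\<close>
    obtain R where R: "dipath G (mate x) R (s, \<beta>)" "distinct R"
      using tr[of "mate x"] xy by auto
    from dipath_first_entry[OF R(1), of "verts H"] obtain R1 h R2 p q where
      h: "R = R1 @ h # R2" "dipath G (mate x) R1 p" "step G h p q"
      "fst p \<notin> verts H" "fst q \<in> verts H" "\<forall>f\<in>set R1. ends G f \<inter> verts H = {}"
      using e assms(3) by auto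
    obtain us where us: "vpath G (mate x) us R1 p"
      using h(2) dipath_iff_vpath by blast
    have ex: "step G e (mate y) (mate x)"
      using step_mate[OF e(1)] .
    have eR1: "e \<notin> set R1"
      using step_ends[OF e(1)] h(6) e(3) by blast
    have "set R1 \<inter> edges H = {}"
    proof (rule ccontr)
      assume "set R1 \<inter> edges H \<noteq> {}"
      then obtain f where f: "f \<in> set R1" "f \<in> edges H"
        by blast
      then have "ends G f \<subseteq> verts H" "ends G f \<noteq> {}"
        using subgraph_ends_subset[OF sub] bidirected_graph_ends[OF bG, of f] sub
        by (blast, metis insert_not_empty subgraph_def subsetD)
      then show False
        using f h(6) by blast
    qed
    moreover have "e \<notin> edges H" "h \<notin> edges H"
      using subgraph_ends_subset[OF sub] step_ends[OF e(1)] step_ends[OF h(3)] e h by auto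
    ultimately have disj: "set (e # R1 @ [h]) \<inter> edges H = {}"
      by auto
    let ?vs = "fst y # us @ [fst q]"
    have vp: "vpath G (mate y) ?vs (e # R1 @ [h]) q"
      using ex vpath_snoc[OF us h(3)] by auto
    then have dw: "diwalk G ?vs (e # R1 @ [h])"
      using vpath_diwalk[OF bG vp] xy by simp
    have "diear G H ?vs (e # R1 @ [h])"
    proof (cases "h = e")
      case False
      then have "distinct (e # R1 @ [h])"
        using R h eR1 by auto
      then show ?thesis
        using sub dw disj e h by (simp add: diear_def simple_diear_def ditrail_def)
    next
      case True
      \<comment> \<open>The trail enters \<open>H\<close> through \<open>e\<close> again. As
        \<open>fst p\<close> is outside \<open>H\<close>, it uses \<open>e\<close> from
        \<open>x\<close> to \<open>y\<close>, so \<open>R1\<close> runs from \<open>mate x\<close>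
        to \<open>x\<close> and is closed and nonempty.\<close>
      have "p \<noteq> mate y"
        using e h by auto
      then have p: "p = x" "q = y"
        using step_unique[OF bG e(1)] h(3) True by blast+
      have "R1 \<noteq> []"
        using h(2) p by auto
      moreover have "ditrail G us R1"
        using vpath_diwalk[OF bG us] xy R h by (simp add: ditrail_def)
      moreover have "hd us = fst x" "last us = fst x"
        using vpath_hd[OF us] vpath_last[OF us] p by auto
      ultimately have "nonsimple_diear G H ?vs (e # R1 @ [h])"
        using dw disj e h eR1 True p unfolding nonsimple_diear_def by auto
      then show ?thesis
        using sub by (simp add: diear_def)
    qed
    then show ?thesis by blast
  qed
qed

text \<open>The nonempty diears of \<open>exists_diear\<close> are added until \<open>G\<close> is
  exhausted; each lowers the number of missing edges.\<close>

lemma \<A>_extend: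
  assumes G: "strong_radial \<beta> s G"
  shows "H \<in> \<A> \<beta> s \<Longrightarrow> subgraph H G \<Longrightarrow> G \<in> \<A> \<beta> s"
proof (induction "card (edges G - edges H)" arbitrary: H rule: less_induct)
  case less
  show ?case
  proof (cases "H = G")
    case False
    have "s \<in> verts H"
      using \<A>_strong_radial[OF less.prems(1)] by (simp add: strong_radial_def)
    then obtain vs es where ear: "diear G H vs es" "es \<noteq> []"
      using exists_diear[OF G less.prems(2)] False by blast
    have bG: "bidirected_graph G"
      using G by (simp add: strong_radial_def)
    have w: "walk G vs es" and disj: "set es \<inter> edges H = {}"
      using ear by (auto simp: diear_def simple_diear_def nonsimple_diear_def ditrail_def diwalk_def)
    have "ends G e \<subseteq> verts H \<union> set vs" if "e \<in> edges H \<union> set es" for e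
      using that walk_graph_subset(3)[OF w] subgraph_ends_subset[OF less.prems(2)] by blast
    then have "subgraph (restrict_graph G (verts H \<union> set vs) (edges H \<union> set es)) G"
      by (intro subgraph_restrict_graph)
        (use bG less.prems(2) walk_graph_subset[OF w] in \<open>auto simp: subgraph_def\<close>)
    then have sub: "subgraph (gunion H (walk_graph G vs es)) G"
      by (simp add: gunion_walk_graph[OF less.prems(2)])
    have "hd es \<in> edges G - edges H" "hd es \<in> set es"
      using ear(2) disj walk_graph_subset(2)[OF w] by (auto simp: hd_in_set disjoint_iff subset_iff)
    then have "edges G - edges (gunion H (walk_graph G vs es)) \<subset> edges G - edges H"
      by (auto simp: gunion_def walk_graph_def)
    then have "card (edges G - edges (gunion H (walk_graph G vs es))) < card (edges G - edges H)"
      using bG by (intro psubset_card_mono) (auto simp: bidirected_graph_def)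
    then show ?thesis
      using less.hyps \<A>.add_diear[OF less.prems(1) ear(1)] sub by blast
  qed (use less.prems in simp)
qed

lemma \<A>_iff_strong_radial: "G \<in> \<A> \<beta> s \<longleftrightarrow> strong_radial \<beta> s G"
proof
  assume G: "strong_radial \<beta> s G"
  then have bG: "bidirected_graph G" and s: "s \<in> verts G"
    by (auto simp: strong_radial_def)
  \<comment> \<open>The strong condition at the root itself provides the closed ditrail that starts
    the decomposition.\<close>
  obtain es where "trail G (s, - \<beta>) es (s, \<beta>)"
    using G s by (auto simp: strong_radial_def)
  then obtain vs where vp: "vpath G (s, - \<beta>) vs es (s, - (- \<beta>))" "distinct es"
    by (auto simp: trail_def dipath_iff_vpath)
  then have sd: "signed_ditrail G (- \<beta>) (- \<beta>) vs es"
    using trail_signed_ditrail[OF bG] s by blast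
  then have w: "walk G vs es"
    by (simp add: signed_ditrail_def ditrail_def diwalk_def)
  have "walk_graph G vs es \<in> \<A> \<beta> s"
    using \<A>.closed_ditrail[OF bG sd] vpath_hd[OF vp(1)] vpath_last[OF vp(1)] by simp
  moreover have "subgraph (walk_graph G vs es) G"
    unfolding walk_graph_eq using bG walk_graph_subset[OF w] by (intro subgraph_restrict_graph)
  ultimately show "G \<in> \<A> \<beta> s"
    using \<A>_extend[OF G] by blast
qed (rule \<A>_strong_radial)

subsection \<open>The three constructions\<close>

lemma add_edge_simps [simp]:
  "verts (add_edge G e u a v b) = {u, v} \<union> verts G"
  "edges (add_edge G e u a v b) = insert e (edges G)"
  by (simp_all add: add_edge_def)

lemma bidirected_graph_add_edge:
  assumes "bidirected_graph G"
  shows "bidirected_graph (add_edge G e u a v b)"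
proof -
  let ?G = "add_edge G e u a v b"
  have e: "ends ?G e = {u, v} \<and> (u \<noteq> v \<longrightarrow> bd ?G Pos e \<inter> bd ?G Neg e = {})"
    by (cases a; cases b) (auto simp: ends_def add_edge_def)
  have other: "ends ?G f = ends G f" "bd ?G c f = bd G c f" if "f \<noteq> e" for f c
    using that by (auto simp: ends_def add_edge_def)
  have "\<exists>x\<in>verts ?G. \<exists>y\<in>verts ?G. ends ?G f = {x, y} \<and> (x \<noteq> y \<longrightarrow> bd ?G Pos f \<inter> bd ?G Neg f = {})"
    if "f \<in> edges ?G" for f
  proof (cases "f = e")
    case True
    then show ?thesis
      using e by (intro bexI[of _ u] bexI[of _ v]) auto
  next
    case False
    then have "f \<in> edges G"
      using that by simp
    then obtain x y where "x \<in> verts G" "y \<in> verts G" "ends G f = {x, y}"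
      "x \<noteq> y \<longrightarrow> bd G Pos f \<inter> bd G Neg f = {}"
      using bidirected_graph_ends[OF assms] by metis
    then show ?thesis
      using other[OF False] by (intro bexI[of _ x] bexI[of _ y]) auto
  qed
  moreover have "bd ?G c f = {}" if "f \<notin> edges ?G" for c f
    using that assms other(2)[of f c] by (auto simp: bidirected_graph_def)
  ultimately show ?thesis
    using assms unfolding bidirected_graph_def by simp
qed

lemma subgraph_add_edge:
  "bidirected_graph G \<Longrightarrow> e \<notin> edges G \<Longrightarrow> subgraph G (add_edge G e u a v b)"
  using bidirected_graph_add_edge[of G]
  by (auto simp: subgraph_def agree_def add_edge_def)

lemma step_add_edge: "step (add_edge G e u a v b) e (u, a) (v, - b)"
  by (cases a; cases b) (auto simp: step_def ends_def add_edge_def)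

lemma add_edge_restrict_graph:
  assumes "bidirected_graph G" "step G e (u, a) (v, - b)" "{u, v} \<union> V = verts G"
  shows "add_edge (restrict_graph G V (edges G - {e})) e u a v b = G"
proof -
  have "bd G c f = {}" if "f \<notin> edges G" for c f
    using that assms(1) by (simp add: bidirected_graph_def)
  then have "bd (add_edge (restrict_graph G V (edges G - {e})) e u a v b) = bd G"
    using bd_eq_of_step[OF assms(1,2)] by (auto simp: add_edge_def fun_eq_iff)
  then show ?thesis
    using assms(3) step_edge[OF assms(2)] by (intro bigraph.equality) auto
qed

text \<open>Trails of \<open>G\<close> are prolonged by \<open>e\<close>, the only edge at
  \<open>r\<close>. A closed trail from \<open>(r, - \<alpha>)\<close> would spend \<open>e\<close>
  at once and then stay in \<open>G\<close>, which misses \<open>r\<close>.\<close>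

lemma almost_strong_radial_new_root:
  assumes G: "strong_radial \<beta> r' G" and "r' \<noteq> r" "r \<notin> verts G" "e \<notin> edges G"
  shows "almost_strong_radial \<alpha> r (add_edge G e r (- \<alpha>) r' \<beta>)"
proof -
  let ?G = "add_edge G e r (- \<alpha>) r' \<beta>"
  have bG: "bidirected_graph G" and r': "r' \<in> verts G"
    using G by (auto simp: strong_radial_def)
  have sub: "subgraph G ?G"
    using subgraph_add_edge[OF bG assms(4)] .
  have bG': "bidirected_graph ?G"
    using bidirected_graph_add_edge[OF bG] .
  have st: "step ?G e (r, - \<alpha>) (r', - \<beta>)"
    by (rule step_add_edge)
  have "\<exists>es. trail ?G (v, a) es (r, \<alpha>)" if "v \<in> verts ?G - {r}" for v a
  proof -
    have "v \<in> verts G"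
      using that r' by auto
    then obtain es where "trail G (v, a) es (r', \<beta>)"
      using G by (auto simp: strong_radial_def)
    moreover have "e \<notin> set es"
      using calculation assms(4) dipath_edges by (fastforce simp: trail_def)
    ultimately have "trail ?G (v, a) (es @ [e]) (r, \<alpha>)"
      using step_mate[OF st] by (auto simp: trail_append trail_Cons trail_subgraph_iff[OF sub])
    then show ?thesis ..
  qed
  moreover have "\<not> trail ?G (r, - \<alpha>) es (r, \<alpha>)" for es
  proof
    assume tr: "trail ?G (r, - \<alpha>) es (r, \<alpha>)"
    then obtain f es' u where es: "es = f # es'" "step ?G f (r, - \<alpha>) u" "trail ?G u es' (r, \<alpha>)"
      "f \<notin> set es'"
      by (cases es) (auto simp: trail_Cons)
    have "r \<in> ends ?G f"
      using step_ends[OF es(2)] by simp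
    then have "f \<notin> edges G"
      using subgraph_ends_subset[OF sub] assms(3) by blast
    then have f: "f = e"
      using step_edge[OF es(2)] by simp
    then have "u = (r', - \<beta>)"
      using step_unique[OF bG' st] es(2) assms(2) by fastforce
    moreover have "set es' \<subseteq> edges G"
      using dipath_edges[of ?G u es'] es f by (auto simp: trail_def)
    ultimately have "trail G (r', - \<beta>) es' (r, \<alpha>)"
      using es by (simp add: trail_subgraph_iff[OF sub])
    then show False
      using dipath_verts[OF bG, of "(r', - \<beta>)" es' "(r, \<alpha>)"] r' assms(3) by (simp add: trail_def)
  qed
  ultimately show ?thesis
    using bG' by (simp add: almost_strong_radial_iff)
qed

text \<open>Crossing the new edge means leaving \<open>(r, \<alpha>)\<close> or arriving at
  \<open>(r, - \<alpha>)\<close>; the piece of a forbidden trail before or after it would then be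
  forbidden in \<open>G\<close> already.\<close>

lemma almost_strong_radial_add_edge_root:
  assumes G: "almost_strong_radial \<alpha> r G" and "v \<in> verts G" "e \<notin> edges G"
  shows "almost_strong_radial \<alpha> r (add_edge G e r \<alpha> v \<gamma>)"
proof -
  let ?G = "add_edge G e r \<alpha> v \<gamma>"
  have bG: "bidirected_graph G" and r: "r \<in> verts G"
    and ex: "\<forall>v\<in>verts G - {r}. \<forall>a. \<exists>es. trail G (v, a) es (r, \<alpha>)"
    and no: "\<nexists>es. trail G (r, - \<alpha>) es (r, \<alpha>)"
    using G by (auto simp: almost_strong_radial_iff)
  have sub: "subgraph G ?G"
    using subgraph_add_edge[OF bG assms(3)] .
  have bG': "bidirected_graph ?G"
    using bidirected_graph_add_edge[OF bG] .
  have old: "\<not> trail ?G (r, - \<alpha>) es (r, \<alpha>)" if "e \<notin> set es" for es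
  proof
    assume tr: "trail ?G (r, - \<alpha>) es (r, \<alpha>)"
    have "set es \<subseteq> edges ?G"
      using tr dipath_edges unfolding trail_def by blast
    then have "set es \<subseteq> edges G"
      using that by auto
    then show False
      using tr no by (auto simp: trail_subgraph_iff[OF sub])
  qed
  have "\<not> trail ?G (r, - \<alpha>) es (r, \<alpha>)" for es
  proof (cases "e \<in> set es")
    case True
    then obtain A B where es: "es = A @ e # B"
      using split_list by metis
    show ?thesis
    proof
      assume "trail ?G (r, - \<alpha>) es (r, \<alpha>)"
      then obtain y z where tr: "trail ?G (r, - \<alpha>) A y" "step ?G e y z" "trail ?G z B (r, \<alpha>)"
        "e \<notin> set A" "e \<notin> set B"
        unfolding es trail_append trail_Cons by auto
      have "y = (r, \<alpha>) \<or> z = (r, - \<alpha>)"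
        using step_unique[OF bG' step_add_edge tr(2)] by auto
      then show False
        using tr old by blast
    qed
  qed (rule old)
  moreover have "\<exists>es. trail ?G (w, a) es (r, \<alpha>)" if "w \<in> verts ?G - {r}" for w a
  proof -
    have "w \<in> verts G - {r}"
      using that assms(2) by auto
    then show ?thesis
      using ex trail_subgraph_iff[OF sub] by blast
  qed
  ultimately show ?thesis
    using bG' by (simp add: almost_strong_radial_iff)
qed

section \<open>Unions of graphs that share only the root\<close>

lemma subgraph_gunion:
  assumes "bidirected_graph G" "bidirected_graph H" "agree G H"
  shows "subgraph G (gunion G H)" "subgraph H (gunion G H)"
proof -
  let ?U = "gunion G H"
  have bd: "bd ?U c e = bd G c e" if "e \<in> edges G" for c e
  proof (cases "e \<in> edges H")
    case True
    then show ?thesis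
      using assms(3) that by (simp add: agree_def gunion_def)
  next
    case False
    then show ?thesis
      using assms(2) by (simp add: bidirected_graph_def gunion_def)
  qed
  have bd': "bd ?U c e = bd H c e" if "e \<in> edges H" for c e
  proof (cases "e \<in> edges G")
    case True
    then show ?thesis
      using assms(3) that by (simp add: agree_def gunion_def)
  next
    case False
    then show ?thesis
      using assms(1) by (simp add: bidirected_graph_def gunion_def)
  qed
  have "\<exists>u\<in>verts ?U. \<exists>v\<in>verts ?U. ends ?U e = {u, v} \<and> (u \<noteq> v \<longrightarrow> bd ?U Pos e \<inter> bd ?U Neg e = {})"
    if "e \<in> edges ?U" for e
  proof (cases "e \<in> edges G")
    case True
    obtain u v where "u \<in> verts G" "v \<in> verts G" "ends G e = {u, v}"
      "u \<noteq> v \<longrightarrow> bd G Pos e \<inter> bd G Neg e = {}"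
      using bidirected_graph_ends[OF assms(1) True] by metis
    then show ?thesis
      using bd[OF True] by (intro bexI[of _ u] bexI[of _ v]) (auto simp: ends_def gunion_def)
  next
    case False
    then have "e \<in> edges H"
      using that by (simp add: gunion_def)
    obtain u v where "u \<in> verts H" "v \<in> verts H" "ends H e = {u, v}"
      "u \<noteq> v \<longrightarrow> bd H Pos e \<inter> bd H Neg e = {}"
      using bidirected_graph_ends[OF assms(2) \<open>e \<in> edges H\<close>] by metis
    then show ?thesis
      using bd'[OF \<open>e \<in> edges H\<close>]
      by (intro bexI[of _ u] bexI[of _ v]) (auto simp: ends_def gunion_def)
  qed
  then have "bidirected_graph ?U"
    using assms(1,2) unfolding bidirected_graph_def by (simp add: gunion_def)
  then show "subgraph G ?U" "subgraph H ?U"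
    using assms bd bd' by (auto simp: subgraph_def agree_def gunion_def)
qed

text \<open>A part can be left only at the vertex of \<open>t\<close>. There the path is in state
  \<open>t\<close>, and may be cut, or in state \<open>mate t\<close>, from where a strictly shorter
  suffix leads to \<open>t\<close>.\<close>

lemma dipath_in_part:
  assumes sub: "subgraph G U"
    and part: "\<And>e. e \<in> edges U \<Longrightarrow> ends U e \<inter> (verts G - {fst t}) \<noteq> {} \<Longrightarrow> e \<in> edges G"
  shows "dipath U x es t \<Longrightarrow> fst x \<in> verts G \<Longrightarrow> x \<noteq> mate t \<Longrightarrow>
    (\<exists>es1 es2. es = es1 @ es2 \<and> dipath G x es1 t) \<or>
    (\<exists>es1 es2. es = es1 @ es2 \<and> es1 \<noteq> [] \<and> dipath U (mate t) es2 t)"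
proof (induction es arbitrary: x)
  case (Cons e es)
  then obtain y where y: "step U e x y" "dipath U y es t"
    by auto
  show ?case
  proof (cases "x = t")
    case True
    then show ?thesis
      by (intro disjI1 exI[of _ "[]"] exI[of _ "e # es"]) auto
  next
    case False
    then have "fst x \<noteq> fst t"
      using Cons.prems(3) fst_eq_cases by blast
    then have e: "e \<in> edges G"
      using part[OF step_edge[OF y(1)]] step_ends[OF y(1)] Cons.prems(2) by auto
    then have st: "step G e x y"
      using y(1) by (simp add: step_subgraph_iff[OF sub])
    show ?thesis
    proof (cases "y = mate t")
      case True
      then show ?thesis
        using y(2) by (intro disjI2 exI[of _ "[e]"] exI[of _ es]) auto
    next
      case False
      have "fst y \<in> verts G"
        using step_verts(2)[OF _ st] sub by (simp add: subgraph_def)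
      from Cons.IH[OF y(2) this False] show ?thesis
      proof (elim disjE exE conjE)
        fix es1 es2 assume "es = es1 @ es2" "dipath G y es1 t"
        then show ?thesis
          using st by (intro disjI1 exI[of _ "e # es1"] exI[of _ es2]) auto
      next
        fix es1 es2 assume "es = es1 @ es2" "es1 \<noteq> []" "dipath U (mate t) es2 t"
        then show ?thesis
          by (intro disjI2 exI[of _ "e # es1"] exI[of _ es2]) auto
      qed
    qed
  qed
qed auto

text \<open>The first edge lies in one part. By \<open>dipath_in_part\<close> the trail closes up
  within that part or passes \<open>mate t\<close> again, which leaves a shorter closed trail for
  the induction.\<close>

lemma no_closed_trail_union:
  assumes sub: "subgraph G U" "subgraph H U" and edges: "edges U = edges G \<union> edges H"
    and verts: "verts G \<inter> verts H = {fst t}"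
    and no: "\<nexists>es. trail G (mate t) es t" "\<nexists>es. trail H (mate t) es t"
  shows "\<not> trail U (mate t) es t"
proof (induction "length es" arbitrary: es rule: less_induct)
  case less
  show ?case
  proof
    assume "trail U (mate t) es t"
    then obtain e es' y where es: "es = e # es'" and y: "step U e (mate t) y" "dipath U y es' t"
      and d: "distinct (e # es')"
      by (cases es) (auto simp: trail_def)
    have False
      if K: "subgraph K U" "e \<in> edges K" "\<nexists>es. trail K (mate t) es t"
        and part: "\<And>e. e \<in> edges U \<Longrightarrow> ends U e \<inter> (verts K - {fst t}) \<noteq> {} \<Longrightarrow> e \<in> edges K" for K
    proof -
      have st: "step K e (mate t) y"
        using y(1) K by (simp add: step_subgraph_iff)
      then have yK: "fst y \<in> verts K"
        using step_verts(2)[OF _ st] K by (simp add: subgraph_def)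
      show False
      proof (cases "y = mate t")
        case True
        then show False
          using less.hyps[of es'] y(2) d es by (simp add: trail_def)
      next
        case False
        have "(\<exists>es1 es2. es' = es1 @ es2 \<and> dipath K y es1 t) \<or>
            (\<exists>es1 es2. es' = es1 @ es2 \<and> es1 \<noteq> [] \<and> dipath U (mate t) es2 t)"
          by (rule dipath_in_part[OF K(1) _ y(2) yK False]) (rule part)
        then show False
        proof (elim disjE exE conjE)
          fix es1 es2 assume "es' = es1 @ es2" "dipath K y es1 t"
          then have "trail K (mate t) (e # es1) t"
            using st d by (auto simp: trail_def)
          then show False
            using K(3) by blast
        next
          fix es1 es2 assume "es' = es1 @ es2" "es1 \<noteq> []" "dipath U (mate t) es2 t"
          then show False
            using less.hyps[of es2] d es by (simp add: trail_def)
        qed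
      qed
    qed
    moreover have "e \<in> edges G \<or> e \<in> edges H"
      using step_edge[OF y(1)] edges by auto
    moreover have "f \<in> edges G"
      if "f \<in> edges U" "ends U f \<inter> (verts G - {fst t}) \<noteq> {}" for f
      using that edges verts subgraph_ends_subset[OF sub(2)] by blast
    moreover have "f \<in> edges H"
      if "f \<in> edges U" "ends U f \<inter> (verts H - {fst t}) \<noteq> {}" for f
      using that edges verts subgraph_ends_subset[OF sub(1)] by blast
    ultimately show False
      using sub no by metis
  qed
qed

lemma almost_strong_radial_union:
  assumes "almost_strong_radial \<alpha> r G" "almost_strong_radial \<alpha> r H"
    and "verts G \<inter> verts H = {r}" "agree G H"
  shows "almost_strong_radial \<alpha> r (gunion G H)"
proof -
  have G: "bidirected_graph G" "r \<in> verts G" and H: "bidirected_graph H"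
    and ex: "\<forall>v\<in>verts G - {r}. \<forall>a. \<exists>es. trail G (v, a) es (r, \<alpha>)"
      "\<forall>v\<in>verts H - {r}. \<forall>a. \<exists>es. trail H (v, a) es (r, \<alpha>)"
    and no: "\<nexists>es. trail G (r, - \<alpha>) es (r, \<alpha>)" "\<nexists>es. trail H (r, - \<alpha>) es (r, \<alpha>)"
    using assms by (auto simp: almost_strong_radial_iff)
  note sub = subgraph_gunion[OF G(1) H assms(4)]
  have "\<not> trail (gunion G H) (mate (r, \<alpha>)) es (r, \<alpha>)" for es
    by (rule no_closed_trail_union[OF sub]) (use no assms in \<open>auto simp: gunion_def\<close>)
  moreover have "\<exists>es. trail (gunion G H) (v, a) es (r, \<alpha>)"
    if "v \<in> verts (gunion G H) - {r}" for v a
  proof -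
    have "v \<in> verts G - {r} \<or> v \<in> verts H - {r}"
      using that by (auto simp: gunion_def)
    then show ?thesis
      using ex trail_subgraph_iff[OF sub(1)] trail_subgraph_iff[OF sub(2)] by blast
  qed
  ultimately show ?thesis
    using G sub(1) by (auto simp: almost_strong_radial_iff subgraph_def)
qed

lemma \<N>_almost_strong_radial: "G \<in> \<N> \<alpha> r \<Longrightarrow> almost_strong_radial \<alpha> r G"
  by (induction rule: \<N>.induct)
    (auto simp: \<A>_iff_strong_radial intro: almost_strong_radial_new_root
      almost_strong_radial_add_edge_root almost_strong_radial_union)

subsection \<open>Decomposing almost strong radials\<close>

text \<open>A shortest trail to \<open>(r, \<alpha>)\<close> avoids \<open>e\<close>: crossing it
  means leaving \<open>(r, \<alpha>)\<close>, where the trail could have stopped, or arriving at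
  \<open>(r, - \<alpha>)\<close>, from where the rest is forbidden.\<close>

lemma almost_strong_radial_delete_edge:
  assumes G: "almost_strong_radial \<alpha> r G" and st: "step G e (r, \<alpha>) s"
  shows "almost_strong_radial \<alpha> r (restrict_graph G (verts G) (edges G - {e}))"
proof -
  have bG: "bidirected_graph G" and r: "r \<in> verts G"
    and ex: "\<forall>v\<in>verts G - {r}. \<forall>a. \<exists>es. trail G (v, a) es (r, \<alpha>)"
    and no: "\<nexists>es. trail G (r, - \<alpha>) es (r, \<alpha>)"
    using G by (auto simp: almost_strong_radial_iff)
  have sub: "subgraph (restrict_graph G (verts G) (edges G - {e})) G"
    using bG ends_subset_verts[OF bG] by (intro subgraph_restrict_graph) auto
  have "\<exists>es. trail G (v, a) es (r, \<alpha>) \<and> e \<notin> set es" if v: "v \<in> verts G - {r}" for v a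
  proof -
    obtain es where es: "trail G (v, a) es (r, \<alpha>)"
      and min: "\<And>es'. trail G (v, a) es' (r, \<alpha>) \<Longrightarrow> length es \<le> length es'"
      using ex v exists_least_iff[of "\<lambda>n. \<exists>es. length es = n \<and> trail G (v, a) es (r, \<alpha>)"]
      by (metis not_le)
    have "e \<notin> set es"
    proof
      assume "e \<in> set es"
      then obtain A B where eq: "es = A @ e # B"
        using split_list by metis
      then obtain y z where tr: "trail G (v, a) A y" "step G e y z" "trail G z B (r, \<alpha>)"
        using es unfolding eq trail_append trail_Cons by auto
      have "y = (r, \<alpha>) \<or> z = (r, - \<alpha>)"
        using step_unique[OF bG st tr(2)] by auto
      then show False
        using tr no min[of A] eq by auto
    qed
    with es show ?thesis by blast
  qed
  then have "\<exists>es. set es \<subseteq> edges G - {e} \<and> trail G (v, a) es (r, \<alpha>)"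
    if "v \<in> verts G - {r}" for v a
    using that dipath_edges unfolding trail_def by blast
  then show ?thesis
    using r no sub unfolding almost_strong_radial_iff trail_subgraph_iff[OF sub]
    by (auto simp: subgraph_def)
qed

text \<open>A trail from \<open>X\<close> could escape only through \<open>r\<close>. But no edge
  leaves the state \<open>(r, \<alpha>)\<close>, and no trail leads from
  \<open>(r, - \<alpha>)\<close> to the target.\<close>

lemma almost_strong_radial_part:
  assumes G: "almost_strong_radial \<alpha> r G" and no_out: "\<And>e s. \<not> step G e (r, \<alpha>) s"
    and X: "X \<subseteq> verts G - {r}"
    and closed: "\<And>e. e \<in> edges G \<Longrightarrow> ends G e \<inter> X \<noteq> {} \<Longrightarrow> ends G e \<subseteq> insert r X"
  shows "almost_strong_radial \<alpha> r
    (restrict_graph G (insert r X) {e \<in> edges G. ends G e \<subseteq> insert r X})"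
proof -
  let ?E = "{e \<in> edges G. ends G e \<subseteq> insert r X}"
  have bG: "bidirected_graph G" and r: "r \<in> verts G"
    and ex: "\<forall>v\<in>verts G - {r}. \<forall>a. \<exists>es. trail G (v, a) es (r, \<alpha>)"
    and no: "\<nexists>es. trail G (r, - \<alpha>) es (r, \<alpha>)"
    using G by (auto simp: almost_strong_radial_iff)
  have sub: "subgraph (restrict_graph G (insert r X) ?E) G"
    using bG r X by (intro subgraph_restrict_graph) auto
  have stay: "set es \<subseteq> ?E"
    if "trail G x es (r, \<alpha>)" "fst x \<in> insert r X" "x \<noteq> (r, - \<alpha>)" for x es
    using that
  proof (induction es arbitrary: x)
    case (Cons e es)
    obtain y where y: "step G e x y" "trail G y es (r, \<alpha>)"
      using Cons.prems by (auto simp: trail_Cons)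
    have "x \<noteq> (r, \<alpha>)"
      using y(1) no_out by blast
    then have "fst x \<noteq> r"
      using fst_eq_cases[of x "(r, \<alpha>)"] Cons.prems(3) by auto
    then have "fst x \<in> ends G e \<inter> X"
      using Cons.prems(2) step_ends[OF y(1)] by simp
    then have e: "e \<in> ?E"
      using closed step_edge[OF y(1)] by blast
    then have "fst y \<in> insert r X"
      using step_ends[OF y(1)] by auto
    moreover have "y \<noteq> (r, - \<alpha>)"
      using y(2) no by blast
    ultimately show ?case
      using Cons.IH[OF y(2)] e by simp
  qed simp
  have "\<exists>es. set es \<subseteq> ?E \<and> trail G (v, a) es (r, \<alpha>)" if v: "v \<in> X" for v a
  proof -
    obtain es where es: "trail G (v, a) es (r, \<alpha>)"
      using ex X v by blast
    then show ?thesis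
      using stay[OF es] v X by fastforce
  qed
  then show ?thesis
    using no sub unfolding almost_strong_radial_iff trail_subgraph_iff[OF sub]
    by (auto simp: subgraph_def)
qed

text \<open>
  When no edge has sign \<open>\<alpha>\<close> at the root, a vertex \<open>v \<noteq> r\<close> is coloured with the last edge of a
  trail from \<open>v\<close> to the root. Colours do not depend on the trail and are constant on the
  components of \<open>G - r\<close>, so each component is attached to \<open>r\<close> by a single edge.
\<close>

lemma almost_strong_radial_last_edges:
  assumes G: "almost_strong_radial \<alpha> r G" and no_out: "\<And>e s. \<not> step G e (r, \<alpha>) s"
  obtains c where
    "\<And>v a es. v \<in> verts G \<Longrightarrow> v \<noteq> r \<Longrightarrow> trail G (v, a) es (r, \<alpha>) \<Longrightarrow> es \<noteq> [] \<and> last es = c v"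
    "\<And>e u v. e \<in> edges G \<Longrightarrow> ends G e = {u, v} \<Longrightarrow> u \<noteq> r \<Longrightarrow> v \<noteq> r \<Longrightarrow> c u = c v"
proof -
  have bG: "bidirected_graph G" and r: "r \<in> verts G"
    and ex: "\<And>v a. v \<in> verts G \<Longrightarrow> v \<noteq> r \<Longrightarrow> \<exists>es. trail G (v, a) es (r, \<alpha>)"
    and no: "\<nexists>es. trail G (r, - \<alpha>) es (r, \<alpha>)"
    using G by (auto simp: almost_strong_radial_iff)
  have ne: "es \<noteq> []" if "v \<noteq> r" "trail G (v, a) es (r, \<alpha>)" for v a es
    using that by auto
  have opp: "last P = last Q"
    if v: "v \<in> verts G" "v \<noteq> r" and P: "trail G (v, a) P (r, \<alpha>)" and Q: "trail G (v, - a) Q (r, \<alpha>)"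
    for v a P Q
  proof (rule last_edge_eq[OF bG _ no_out _ P])
    show "\<exists>es. trail G s es (r, \<alpha>)" if "fst s \<in> verts G" "fst s \<noteq> fst (r, \<alpha>)" for s
      using ex[of "fst s" "snd s"] that by simp
  qed (use no ne v P Q in auto)
  have same: "last P = last Q"
    if v: "v \<in> verts G" "v \<noteq> r" and P: "trail G (v, a) P (r, \<alpha>)" and Q: "trail G (v, b) Q (r, \<alpha>)"
    for v a b P Q
  proof (cases "b = - a")
    case True
    then show ?thesis using opp v P Q by blast
  next
    case False
    then have "b = a"
      using sign_neq_iff[of "- a" b] by auto
    \<comment> \<open>Two trails from the same state are compared through a third one from its
      mate.\<close>
    moreover obtain R where "trail G (v, - a) R (r, \<alpha>)"
      using ex v by blast
    ultimately show ?thesis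
      using opp v P Q by metis
  qed
  \<comment> \<open>The sign \<open>Pos\<close> is arbitrary: by \<open>same\<close>, every trail
    from \<open>v\<close> has this last edge.\<close>
  define c where "c v = last (SOME es. trail G (v, Pos) es (r, \<alpha>))" for v
  have c: "last es = c v" if "v \<in> verts G" "v \<noteq> r" "trail G (v, a) es (r, \<alpha>)" for v a es
    unfolding c_def using someI_ex[OF ex[OF that(1,2)]] same that by blast
  show thesis
  proof
    show "es \<noteq> [] \<and> last es = c v"
      if "v \<in> verts G" "v \<noteq> r" "trail G (v, a) es (r, \<alpha>)" for v a es
      using c ne that by blast
    show "c u = c v"
      if e: "e \<in> edges G" "ends G e = {u, v}" and uv: "u \<noteq> r" "v \<noteq> r" for e u v
    proof -
      have V: "u \<in> verts G" "v \<in> verts G"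
        using ends_subset_verts[OF bG e(1)] e(2) by auto
      obtain a y where st: "step G e (u, a) y"
        using step_exists_end[OF bG e(1), of u] e(2) by auto
      have "{u, v} = {u, fst y}"
        using step_ends[OF st] e(2) by simp
      then have y: "y = (v, snd y)"
        by (cases y) (auto simp: doubleton_eq_iff)
      obtain P where P: "trail G y P (r, \<alpha>)"
        using ex[OF V(2) uv(2)] y by metis
      then have cv: "P \<noteq> []" "last P = c v"
        using c ne V uv y by metis+
      show "c u = c v"
      \<comment> \<open>If \<open>e\<close> is not on \<open>P\<close>, prepend it. Otherwise cut
        \<open>P\<close> at \<open>e\<close>: some suffix is a trail from \<open>u\<close>, with
        sign \<open>a\<close> or \<open>- a\<close>, ending in the same edge as
        \<open>P\<close>.\<close>
      proof (cases "e \<in> set P")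
        case False
        then have "trail G (u, a) (e # P) (r, \<alpha>)"
          using st P by (auto simp: trail_Cons)
        then show ?thesis
          using c[OF V(1) uv(1)] cv by fastforce
      next
        case True
        then obtain A B where eq: "P = A @ e # B"
          using split_list by metis
        then obtain y' z' where tr: "step G e y' z'" "trail G z' B (r, \<alpha>)" "e \<notin> set B"
          using P unfolding eq trail_append trail_Cons by auto
        consider "y' = (u, a)" | "z' = (u, - a)"
          using step_unique[OF bG st tr(1)] by auto
        then show ?thesis
        proof cases
          case 1
          then have "trail G (u, a) (e # B) (r, \<alpha>)"
            using tr by (auto simp: trail_Cons)
          then show ?thesis
            using c[OF V(1) uv(1)] cv eq by fastforce
        next
          case 2
          then have "B \<noteq> []" "last B = c u"
            using tr(2) c[OF V(1) uv(1)] ne uv by blast+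
          then show ?thesis
            using cv eq by simp
        qed
      qed
    qed
  qed
qed

text \<open>The cases mirror the constructors: an edge with sign \<alpha> at \<open>r\<close> is
  deleted for \<open>add_edge_root\<close>; without such edges, a single colour gives
  \<open>new_root\<close> and several colours give \<open>union\<close>.\<close>

lemma almost_strong_radial_\<N>:
  "almost_strong_radial \<alpha> r G \<Longrightarrow> verts G \<noteq> {r} \<Longrightarrow> G \<in> \<N> \<alpha> r"
proof (induction "card (verts G) + card (edges G)" arbitrary: G rule: less_induct)
  case less
  note G = less.prems(1)
  have bG: "bidirected_graph G" and r: "r \<in> verts G"
    and ex: "\<And>v a. v \<in> verts G \<Longrightarrow> v \<noteq> r \<Longrightarrow> \<exists>es. trail G (v, a) es (r, \<alpha>)"
    and no: "\<nexists>es. trail G (r, - \<alpha>) es (r, \<alpha>)"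
    using G by (auto simp: almost_strong_radial_iff)
  have fin: "finite (verts G)" "finite (edges G)"
    using bG by (auto simp: bidirected_graph_def)
  show ?case
  proof (cases "\<exists>e s. step G e (r, \<alpha>) s")
    case True
    then obtain e v b where st: "step G e (r, \<alpha>) (v, b)"
      by (metis surj_pair)
    let ?G = "restrict_graph G (verts G) (edges G - {e})"
    have "card (edges G - {e}) < card (edges G)"
      using step_edge[OF st] fin by (intro psubset_card_mono) auto
    then have "?G \<in> \<N> \<alpha> r"
      using less.hyps almost_strong_radial_delete_edge[OF G st] less.prems(2) by simp
    \<comment> \<open>The state \<open>(v, b)\<close> is entered with sign \<open>- b\<close>, which
      is therefore the sign of \<open>v\<close> over \<open>e\<close>.\<close>
    moreover have "add_edge ?G e r \<alpha> v (- b) = G"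
      using step_verts[OF bG st] st by (intro add_edge_restrict_graph[OF bG]) auto
    ultimately show ?thesis
      using \<N>.add_edge_root[of ?G \<alpha> r v e "- b"] step_verts[OF bG st] by simp
  next
    case False
    then have no_out: "\<And>e s. \<not> step G e (r, \<alpha>) s"
      by blast
    obtain c where
      c: "\<And>v a es. v \<in> verts G \<Longrightarrow> v \<noteq> r \<Longrightarrow> trail G (v, a) es (r, \<alpha>) \<Longrightarrow> es \<noteq> [] \<and> last es = c v"
      and adj: "\<And>e u v. e \<in> edges G \<Longrightarrow> ends G e = {u, v} \<Longrightarrow> u \<noteq> r \<Longrightarrow> v \<noteq> r \<Longrightarrow> c u = c v"
      by (rule almost_strong_radial_last_edges[OF G no_out]) (rule that)
    obtain v0 where v0: "v0 \<in> verts G" "v0 \<noteq> r"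
      using less.prems(2) r by blast
    define C where "C = {v \<in> verts G - {r}. c v = c v0}"
    define D where "D = {v \<in> verts G - {r}. c v \<noteq> c v0}"
    show ?thesis
    proof (cases "D = {}")
      case True
      then have c0: "c v = c v0" if "v \<in> verts G" "v \<noteq> r" for v
        using that by (auto simp: D_def)
      \<comment> \<open>The only colour, which turns out to be the only edge at
        \<open>r\<close>.\<close>
      define f where "f = c v0"
      have split: "\<exists>es' x. es = es' @ [f] \<and> trail G (v, a) es' x \<and> step G f x (r, \<alpha>) \<and> f \<notin> set es'"
        if v: "v \<in> verts G" "v \<noteq> r" "trail G (v, a) es (r, \<alpha>)" for v a es
      proof -
        have "es = butlast es @ [f]"
          using c[OF v] c0[OF v(1,2)] append_butlast_last_id unfolding f_def by metis
        moreover from this obtain x where "trail G (v, a) (butlast es) x" "step G f x (r, \<alpha>)"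
          "f \<notin> set (butlast es)"
          using v(3) trail_append[of G "(v, a)" "butlast es" "[f]"] by (auto simp: trail_Cons)
        ultimately show ?thesis by blast
      qed
      obtain es0 where "trail G (v0, Pos) es0 (r, \<alpha>)"
        using ex[OF v0] by blast
      then obtain r' \<beta> where f: "step G f (r', \<beta>) (r, \<alpha>)"
        using split[OF v0] by (metis surj_pair)
      have r': "r' \<in> verts G" "r' \<noteq> r"
      proof -
        show "r' \<in> verts G"
          using step_verts[OF bG f] by simp
        show "r' \<noteq> r"
        proof
          assume "r' = r"
          then consider "(r', \<beta>) = (r, \<alpha>)" | "(r', \<beta>) = (r, - \<alpha>)"
            using fst_eq_cases[of "(r', \<beta>)" "(r, \<alpha>)"] by auto
          then show False
          proof cases
            case 1
            then show False using f no_out by blast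
          next
            case 2
            then have "trail G (r, - \<alpha>) [f] (r, \<alpha>)"
              using f by (auto simp: trail_Cons)
            then show False using no by blast
          qed
        qed
      qed
      have uniq: "x = (r', \<beta>)" if "step G f x (r, \<alpha>)" for x
        using step_unique[OF bG f that] r' by auto
      \<comment> \<open>An edge at \<open>r\<close> has sign \<open>- \<alpha>\<close> there and is
        not a loop, so it is by itself a trail to \<open>(r, \<alpha>)\<close>; hence it is the last
        edge \<open>f\<close>.\<close>
      have only: "e = f" if e: "e \<in> edges G" "r \<in> ends G e" for e
      proof -
        obtain b z where z: "step G e (r, b) z"
          using step_exists_end[OF bG e] by blast
        then have "b = - \<alpha>"
          using no_out by (metis sign_neq_iff)
        then have z': "step G e (mate z) (r, \<alpha>)"
          using step_mate[OF z] by simp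
        then have tr: "trail G (mate z) [e] (r, \<alpha>)"
          by (auto simp: trail_Cons)
        have "mate z \<noteq> (r, \<alpha>)" "mate z \<noteq> (r, - \<alpha>)"
          using z' no_out tr no by metis+
        then have "fst z \<noteq> r"
          using fst_eq_cases[of "mate z" "(r, \<alpha>)"] by auto
        moreover have "fst z \<in> verts G"
          using step_verts[OF bG z] by simp
        moreover have "mate z = (fst z, - snd z)"
          by (simp add: mate_def)
        ultimately show ?thesis
          using split[of "fst z" "- snd z" "[e]"] tr by auto
      qed
      \<comment> \<open>Dropping the final \<open>f\<close> turns trails to
        \<open>(r, \<alpha>)\<close> into trails to \<open>(r', \<beta>)\<close>; by
        \<open>only\<close>, the remaining edges miss \<open>r\<close>.\<close>
      let ?H = "restrict_graph G (verts G - {r}) (edges G - {f})"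
      have "strong_radial \<beta> r' ?H"
      proof (rule strong_radial_restrict_graph[OF bG])
        show "ends G e \<subseteq> verts G - {r}" if "e \<in> edges G - {f}" for e
          using that only ends_subset_verts[OF bG] by blast
        show "\<exists>es. trail G (v, a) es (r', \<beta>) \<and> set es \<subseteq> edges G - {f}"
          if v: "v \<in> verts G - {r}" for v a
        proof -
          obtain es where "trail G (v, a) es (r, \<alpha>)"
            using ex v by blast
          then obtain es' x where "trail G (v, a) es' x" "step G f x (r, \<alpha>)" "f \<notin> set es'"
            using split v by blast
          moreover from this have "x = (r', \<beta>)"
            using uniq by blast
          ultimately show ?thesis
            using dipath_edges unfolding trail_def by blast
        qed
      qed (use r' in auto)
      then have "?H \<in> \<A> \<beta> r'"
        by (simp add: \<A>_iff_strong_radial)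
      moreover have "add_edge ?H f r (- \<alpha>) r' \<beta> = G"
        using r r' step_mate[OF f] by (intro add_edge_restrict_graph[OF bG]) auto
      ultimately show ?thesis
        using \<N>.new_root[of r' r ?H \<beta> f \<alpha>] r' by simp
    next
      \<comment> \<open>One colour is split from all others. Adjacent vertices other than
        \<open>r\<close> share a colour, so \<open>C\<close> and \<open>D\<close> are connected only
        through \<open>r\<close>.\<close>
      case False
      have CD: "C \<subseteq> verts G - {r}" "D \<subseteq> verts G - {r}" "C \<inter> D = {}" "v0 \<in> C"
        "verts G - {r} = C \<union> D"
        using v0 by (auto simp: C_def D_def)
      have same_colour: "c u = c v"
        if e: "e \<in> edges G" "u \<in> ends G e" "v \<in> ends G e" "u \<noteq> r" "v \<noteq> r" for e u v
      proof (cases "u = v")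
        case False
        obtain x y where "ends G e = {x, y}"
          using bidirected_graph_ends[OF bG e(1)] by metis
        then have "ends G e = {u, v}"
          using False e(2,3) by auto
        then show ?thesis
          using adj e by blast
      qed simp
      have closed: "ends G e \<subseteq> insert r X"
        if X: "X = C \<or> X = D" "e \<in> edges G" "ends G e \<inter> X \<noteq> {}" for X e
      proof
        fix v assume v: "v \<in> ends G e"
        obtain u where u: "u \<in> ends G e" "u \<in> X"
          using X(3) by blast
        then have "u \<noteq> r"
          using X(1) CD by blast
        show "v \<in> insert r X"
        proof (cases "v = r")
          case False
          then have "c u = c v"
            using same_colour[OF X(2) u(1) v] \<open>u \<noteq> r\<close> by blast
          then show ?thesis
            using X(1) u(2) v False ends_subset_verts[OF bG X(2)] by (auto simp: C_def D_def)
        qed simp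
      qed
      define E where "E X = {e \<in> edges G. ends G e \<subseteq> insert r X}" for X
      have part: "restrict_graph G (insert r X) (E X) \<in> \<N> \<alpha> r"
        if X: "X = C \<or> X = D" for X
      proof (rule less.hyps)
        \<comment> \<open>Each part misses the vertices of the other class: \<open>v0\<close> lies
          in \<open>C\<close>, and \<open>D\<close> is nonempty in this case.\<close>
        have XV: "X \<subseteq> verts G - {r}" and "X \<noteq> {}" and "insert r X \<noteq> verts G"
          using X CD False by auto
        then have "card (insert r X) < card (verts G)"
          using fin r by (intro psubset_card_mono) auto
        moreover have "card (E X) \<le> card (edges G)"
          using fin by (intro card_mono) (auto simp: E_def)
        ultimately show "card (verts (restrict_graph G (insert r X) (E X))) +
            card (edges (restrict_graph G (insert r X) (E X))) < card (verts G) + card (edges G)"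
          by simp
        show "almost_strong_radial \<alpha> r (restrict_graph G (insert r X) (E X))"
          unfolding E_def by (rule almost_strong_radial_part[OF G no_out XV closed[OF X]])
        show "verts (restrict_graph G (insert r X) (E X)) \<noteq> {r}"
          using XV \<open>X \<noteq> {}\<close> by auto
      qed
      \<comment> \<open>An edge meeting neither class has \<open>r\<close> as its only end and lies
        in both sets.\<close>
      have "e \<in> E C \<union> E D" if e: "e \<in> edges G" for e
      proof -
        have "ends G e \<subseteq> insert r (C \<union> D)"
          using ends_subset_verts[OF bG e] CD by blast
        then show ?thesis
          using closed[of C e] closed[of D e] e unfolding E_def by blast
      qed
      then have EE: "E C \<union> E D = edges G"
        by (auto simp: E_def)
      have VV: "insert r C \<union> insert r D = verts G"
        using CD r by auto
      have "gunion (restrict_graph G (insert r C) (E C)) (restrict_graph G (insert r D) (E D)) = G"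
        unfolding gunion_restrict_graph EE VV by (rule restrict_graph_id[OF bG])
      moreover have "insert r C \<inter> insert r D = {r}"
        using CD by auto
      ultimately show ?thesis
        using \<N>.union[OF part[of C] part[of D] _ agree_restrict_graph] by simp
    qed
  qed
qed

theorem theorem10p3:
  fixes r :: 'v and \<alpha> :: sign
  shows "(\<N> \<alpha> r :: ('v, 'e) bigraph set) =
    {G. almost_strong_radial \<alpha> r G \<and> verts G \<noteq> {r}}"
proof (intro set_eqI iffI)
  fix G :: "('v, 'e) bigraph"
  assume "G \<in> \<N> \<alpha> r"
  then show "G \<in> {G. almost_strong_radial \<alpha> r G \<and> verts G \<noteq> {r}}"
    using \<N>_almost_strong_radial[of G] \<N>_verts_neq_root[of G] by simp
next
  fix G :: "('v, 'e) bigraph"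
  assume "G \<in> {G. almost_strong_radial \<alpha> r G \<and> verts G \<noteq> {r}}"
  then show "G \<in> \<N> \<alpha> r"
    using almost_strong_radial_\<N>[of \<alpha> r G] by simp
qed

end
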